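(* (Pasting lemma) Let $n\ge2$, $m\ge1$, let $\Theta\subset\mathbf{R}^{n+1}$ be open and let $G\subset\Theta$ be open. Suppose $u$ and $v$ are superparabolic in $\Theta$ and $G$, respectively. Let $$w=\begin{cases}\min\{u,v\}&\text{in }G,\\ u&\text{in }\Theta\setminus G.\end{cases}$$ If $\overline{\{(x,t)\in G:v(x,t)<u(x,t)\}}\cap\Theta\subset G$, then $w$ is superparabolic in $\Theta$.
   Context: Points of $\mathbf{R}^{n+1}$ are $\xi=(x,t)$, $x\in\mathbf{R}^n$, $t\in\mathbf{R}$; $\nabla,\Delta$ are taken with respect to $x$ only. All functions considered are nonnegative. The equation is the porous medium equation $\partial_t u=\Delta u^m$. $A\Subset B$ means that $\overline A$ is a compact subset of $B$. Cylinders: $U_{t_1,t_2}=U\times(t_1,t_2)$ with $U\subset\mathbf{R}^n$ bounded and open, $t_1<t_2$; it is a $C^{2,\alpha}$-cylinder if $U$ is $C^{2,\alpha}$-smooth ($0<\alpha<1$). Its parabolic boundary is $\partial_pU_{t_1,t_2}=(\overline U\times\{t_1\})\cup(\partial U\times(t_1,t_2])$. Parabolic functions: $u:\Theta\to[0,\infty]$ is a weak solution in the open set $\Theta$ if for every cylinder $U_{t_1,t_2}\Subset\Theta$ we have $u\in C([t_1,t_2];L^{m+1}(U))$, $u^m\in L^2(t_1,t_2;W^{1,2}(U))$ and $\int_{t_1}^{t_2}\int_U\nabla u^m\cdot\nabla\varphi\,dx\,dt-\int_{t_1}^{t_2}\int_Uu\,\partial_t\varphi\,dx\,dt=0$ for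 all $\varphi\in C_0^\infty(U_{t_1,t_2})$. Continuous weak solutions are called parabolic. Superparabolic functions: $u:\Theta\to[0,\infty]$ is superparabolic if (i) $u$ is lower semicontinuous; (ii) $u$ is finite in a dense subset of $\Theta$; (iii) for each $C^{2,\alpha}$-cylinder $U_{t_1,t_2}\Subset\Theta$, whenever $h\in C(\overline U_{t_1,t_2})$ is parabolic in $U_{t_1,t_2}$ and $h\le u$ on $\partial_pU_{t_1,t_2}$, then $h\le u$ in $U_{t_1,t_2}$. *)

theory Defs
  imports "HOL-Analysis.Analysis"
begin

text \<open>
  Points of \<open>\<real>\<^sup>n \<times> \<real>\<close> are pairs of type \<open>(real ^ 'n) \<times> real\<close>.  Functions with values in
  \<open>[0,\<infinity>]\<close> are total functions into \<open>ennreal\<close>; every notion below only depends on their values on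
  the set in question.
\<close>

definition compactly_contained :: "'a::topological_space set \<Rightarrow> 'a set \<Rightarrow> bool" where
  "compactly_contained A B \<longleftrightarrow> compact (closure A) \<and> closure A \<subseteq> B"


subsection \<open>Smoothness\<close>

primrec Ck :: "nat \<Rightarrow> ('a::euclidean_space \<Rightarrow> real) \<Rightarrow> bool" where
  "Ck 0 f \<longleftrightarrow> continuous_on UNIV f"
| "Ck (Suc k) f \<longleftrightarrow>
     (\<forall>x. f differentiable (at x)) \<and> (\<forall>v. Ck k (\<lambda>x. frechet_derivative f (at x) v))"

definition test_function :: "'a::euclidean_space set \<Rightarrow> ('a \<Rightarrow> real) \<Rightarrow> bool" where
  "test_function S \<phi> \<longleftrightarrow> (\<forall>k. Ck k \<phi>) \<and> compactly_contained {x. \<phi> x \<noteq> 0} S"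

definition C2_Holder :: "real \<Rightarrow> ('a::euclidean_space \<Rightarrow> real) \<Rightarrow> bool" where
  "C2_Holder \<alpha> f \<longleftrightarrow> Ck 2 f \<and>
     (\<forall>v w. let D = (\<lambda>x. frechet_derivative (\<lambda>y. frechet_derivative f (at y) v) (at x) w)
            in \<exists>C. \<forall>x y. \<bar>D x - D y\<bar> \<le> C * dist x y powr \<alpha>)"

text \<open>
  Near each boundary point, \<open>U\<close> is the strict epigraph, in the direction of a unit vector \<open>e\<close>, of a
  \<open>C\<^sup>2\<^sup>,\<^sup>\<alpha>\<close> function of the \<open>n - 1\<close> variables orthogonal to \<open>e\<close>.  The latter is represented by a
  function on the whole space which is constant in the direction \<open>e\<close>.  Since the condition is only
  imposed in a ball, it is no restriction that the function is globally \<open>C\<^sup>2\<^sup>,\<^sup>\<alpha>\<close> (use a cut-off).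
\<close>

definition C2_Holder_smooth_domain :: "real \<Rightarrow> 'a::euclidean_space set \<Rightarrow> bool" where
  "C2_Holder_smooth_domain \<alpha> U \<longleftrightarrow>
     (\<forall>x0 \<in> frontier U. \<exists>r>0. \<exists>e f. norm e = 1 \<and> C2_Holder \<alpha> f \<and>
        (\<forall>x s. f (x + s *\<^sub>R e) = f x) \<and>
        (\<forall>x \<in> ball x0 r. x \<in> U \<longleftrightarrow> f x < x \<bullet> e))"


subsection \<open>Space-time cylinders\<close>

definition cyl :: "'a set \<Rightarrow> real \<Rightarrow> real \<Rightarrow> ('a \<times> real) set" where
  "cyl U t1 t2 = U \<times> {t1<..<t2}"

definition parabolic_boundary :: "'a::topological_space set \<Rightarrow> real \<Rightarrow> real \<Rightarrow> ('a \<times> real) set" where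
  "parabolic_boundary U t1 t2 = (closure U \<times> {t1}) \<union> (frontier U \<times> {t1<..t2})"

definition cylinder_base :: "'a::metric_space set \<Rightarrow> real \<Rightarrow> real \<Rightarrow> bool" where
  "cylinder_base U t1 t2 \<longleftrightarrow> bounded U \<and> open U \<and> t1 < t2"


subsection \<open>Lebesgue and Sobolev spaces\<close>

definition in_Lp :: "real \<Rightarrow> 'a::euclidean_space set \<Rightarrow> ('a \<Rightarrow> 'b::euclidean_space) \<Rightarrow> bool" where
  "in_Lp p A f \<longleftrightarrow> f \<in> borel_measurable (lebesgue_on A) \<and>
     integrable (lebesgue_on A) (\<lambda>x. norm (f x) powr p)"

definition grad :: "(real ^ 'n \<Rightarrow> real) \<Rightarrow> real ^ 'n \<Rightarrow> real ^ 'n" where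
  "grad \<psi> x = (\<chi> i. frechet_derivative \<psi> (at x) (axis i 1))"

definition weak_gradient :: "(real ^ 'n) set \<Rightarrow> (real ^ 'n \<Rightarrow> real) \<Rightarrow> (real ^ 'n \<Rightarrow> real ^ 'n) \<Rightarrow> bool" where
  "weak_gradient U f g \<longleftrightarrow> (\<forall>\<psi>. test_function U \<psi> \<longrightarrow>
     (\<forall>i. (LINT x|lebesgue_on U. f x * grad \<psi> x $ i) = - (LINT x|lebesgue_on U. g x $ i * \<psi> x)))"

definition W12_with_gradient ::
    "(real ^ 'n) set \<Rightarrow> (real ^ 'n \<Rightarrow> real) \<Rightarrow> (real ^ 'n \<Rightarrow> real ^ 'n) \<Rightarrow> bool" where
  "W12_with_gradient U f g \<longleftrightarrow> in_Lp 2 U f \<and> in_Lp 2 U g \<and> weak_gradient U f g"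

text \<open>
  \<open>f \<in> L\<^sup>2(t1,t2; W\<^sup>1\<^sup>,\<^sup>2(U))\<close> with spatial weak gradient \<open>g\<close>: almost every time slice lies in
  \<open>W\<^sup>1\<^sup>,\<^sup>2(U)\<close>, and \<open>f\<close>, \<open>g\<close> are jointly measurable with the squared \<open>W\<^sup>1\<^sup>,\<^sup>2(U)\<close> norm of the slices
  integrable in time.
\<close>

definition L2_W12_with_gradient ::
    "(real ^ 'n) set \<Rightarrow> real \<Rightarrow> real \<Rightarrow> ((real ^ 'n) \<times> real \<Rightarrow> real) \<Rightarrow> ((real ^ 'n) \<times> real \<Rightarrow> real ^ 'n) \<Rightarrow> bool" where
  "L2_W12_with_gradient U t1 t2 f g \<longleftrightarrow>
     in_Lp 2 (cyl U t1 t2) f \<and> in_Lp 2 (cyl U t1 t2) g \<and>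
     (AE t in lebesgue_on {t1<..<t2}. W12_with_gradient U (\<lambda>x. f (x, t)) (\<lambda>x. g (x, t)))"

text \<open>
  \<open>u \<in> C([t1,t2]; L\<^sup>p(U))\<close>.  An extended-valued function in \<open>L\<^sup>p\<close> is finite almost everywhere; this
  is stated explicitly, because \<open>enn2real\<close> sends \<open>\<infinity>\<close> to \<open>0\<close>.
\<close>

definition C_Lp :: "real \<Rightarrow> 'a::euclidean_space set \<Rightarrow> real \<Rightarrow> real \<Rightarrow> ('a \<times> real \<Rightarrow> ennreal) \<Rightarrow> bool" where
  "C_Lp p U t1 t2 u \<longleftrightarrow>
     (\<forall>t\<in>{t1..t2}. (AE x in lebesgue_on U. u (x, t) < \<infinity>) \<and> in_Lp p U (\<lambda>x. enn2real (u (x, t)))) \<and>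
     (\<forall>s\<in>{t1..t2}.
        ((\<lambda>t. LINT x|lebesgue_on U. \<bar>enn2real (u (x, t)) - enn2real (u (x, s))\<bar> powr p)
           \<longlongrightarrow> 0) (at s within {t1..t2}))"


subsection \<open>The porous medium equation\<close>

definition spatial_grad :: "((real ^ 'n) \<times> real \<Rightarrow> real) \<Rightarrow> (real ^ 'n) \<times> real \<Rightarrow> real ^ 'n" where
  "spatial_grad \<phi> \<xi> = (\<chi> i. frechet_derivative \<phi> (at \<xi>) (axis i 1, 0))"

definition time_deriv :: "((real ^ 'n) \<times> real \<Rightarrow> real) \<Rightarrow> (real ^ 'n) \<times> real \<Rightarrow> real" where
  "time_deriv \<phi> \<xi> = frechet_derivative \<phi> (at \<xi>) (0, 1)"

text \<open>The function \<open>g\<close> is the spatial weak gradient of \<open>u\<^sup>m\<close>, unique up to null sets.\<close>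

definition weak_solution :: "real \<Rightarrow> ((real ^ 'n) \<times> real) set \<Rightarrow> ((real ^ 'n) \<times> real \<Rightarrow> ennreal) \<Rightarrow> bool" where
  "weak_solution m \<Theta> u \<longleftrightarrow>
     (\<forall>U t1 t2. cylinder_base U t1 t2 \<and> compactly_contained (cyl U t1 t2) \<Theta> \<longrightarrow>
        C_Lp (m + 1) U t1 t2 u \<and>
        (\<exists>g. L2_W12_with_gradient U t1 t2 (\<lambda>\<xi>. enn2real (u \<xi>) powr m) g \<and>
          (\<forall>\<phi>. test_function (cyl U t1 t2) \<phi> \<longrightarrow>
             (LINT t|lebesgue_on {t1<..<t2}. LINT x|lebesgue_on U. g (x, t) \<bullet> spatial_grad \<phi> (x, t)) -
             (LINT t|lebesgue_on {t1<..<t2}. LINT x|lebesgue_on U. enn2real (u (x, t)) * time_deriv \<phi> (x, t))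
             = 0)))"

definition parabolic :: "real \<Rightarrow> ((real ^ 'n) \<times> real) set \<Rightarrow> ((real ^ 'n) \<times> real \<Rightarrow> ennreal) \<Rightarrow> bool" where
  "parabolic m \<Theta> u \<longleftrightarrow> weak_solution m \<Theta> u \<and> continuous_on \<Theta> u"

definition lower_semicontinuous_on :: "'a::topological_space set \<Rightarrow> ('a \<Rightarrow> ennreal) \<Rightarrow> bool" where
  "lower_semicontinuous_on S u \<longleftrightarrow> (\<forall>\<xi>\<in>S. \<forall>c<u \<xi>. eventually (\<lambda>\<eta>. c < u \<eta>) (at \<xi> within S))"

text \<open>
  The comparison functions \<open>h\<close>, continuous on the compact closure of the cylinder, are finite and
  nonnegative.
\<close>

definition superparabolic ::
    "real \<Rightarrow> real \<Rightarrow> ((real ^ 'n) \<times> real) set \<Rightarrow> ((real ^ 'n) \<times> real \<Rightarrow> ennreal) \<Rightarrow> bool" where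
  "superparabolic m \<alpha> \<Theta> u \<longleftrightarrow>
     lower_semicontinuous_on \<Theta> u \<and>
     \<Theta> \<subseteq> closure {\<xi>\<in>\<Theta>. u \<xi> < \<infinity>} \<and>
     (\<forall>U t1 t2 (h :: (real ^ 'n) \<times> real \<Rightarrow> real).
        cylinder_base U t1 t2 \<and> C2_Holder_smooth_domain \<alpha> U \<and>
        compactly_contained (cyl U t1 t2) \<Theta> \<and>
        continuous_on (closure (cyl U t1 t2)) h \<and>
        (\<forall>\<xi>\<in>closure (cyl U t1 t2). 0 \<le> h \<xi>) \<and>
        parabolic m (cyl U t1 t2) (\<lambda>\<xi>. ennreal (h \<xi>)) \<and>
        (\<forall>\<xi>\<in>parabolic_boundary U t1 t2. ennreal (h \<xi>) \<le> u \<xi>) \<longrightarrow>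
        (\<forall>\<xi>\<in>cyl U t1 t2. ennreal (h \<xi>) \<le> u \<xi>))"

end

theory Submission
  imports Defs
begin

text \<open>
  Let \<open>h\<close> be a comparison function for \<open>w\<close> on a cylinder \<open>U \<times> (t1, t2)\<close>.  Since \<open>w \<le> u\<close>, the
  superparabolicity of \<open>u\<close> gives \<open>h \<le> u\<close> there, so \<open>h \<le> w\<close> can fail only where \<open>v < u\<close>.  The part \<open>E\<close>
  of the closure of \<open>{v < u}\<close> in the closed cylinder is a compact subset of \<open>G\<close> by hypothesis.
  Hence there is a \<open>\<delta> > 0\<close> such that on every time slab of height at most \<open>\<delta>\<close> the slices of \<open>E\<close> lie
  in a compact set \<open>K\<close> which has an open neighbourhood \<open>Q\<close> with \<open>Q \<times> slab \<subseteq> G\<close>.  One moves forward in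
  time slab by slab: if \<open>h \<le> w\<close> is known up to the time \<open>s0\<close>, compare \<open>h\<close> with \<open>v\<close> on
  \<open>V \<times> (s0, s1)\<close>, where \<open>U \<inter> K \<subseteq> V \<subseteq> U\<close> and \<open>closure V \<subseteq> Q\<close>.  On the bottom \<open>h \<le> w \<le> v\<close> by the
  previous step, on \<open>frontier V \<inter> frontier U\<close> by hypothesis, and the rest of \<open>frontier V\<close> avoids \<open>K\<close>,
  so that \<open>h \<le> u \<le> v\<close> there (\<open>comparison_on_slab\<close>, \<open>pasted_comparison\<close>).

  The comparison property of \<open>v\<close> is only available on \<open>C\<^sup>2\<^sup>,\<^sup>\<alpha>\<close>-cylinders, so the real work is
  \<open>smooth_subdomain\<close>: \<open>V\<close> can be chosen \<open>C\<^sup>2\<^sup>,\<^sup>\<alpha>\<close>-smooth although it must coincide with \<open>U\<close> on \<open>K\<close>,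
  also where \<open>K\<close> meets the frontier of \<open>U\<close>.  An approximation of \<open>U\<close> from inside would not do, because
  \<open>h \<le> w\<close> is known on the frontier of \<open>U\<close> but not near it, and adding a small constant does not
  preserve solutions when \<open>m > 1\<close>.  Take a defining function \<open>\<rho>\<close> of \<open>U = {\<rho> > 0}\<close> with nonvanishing
  derivative on the frontier, and a function \<open>\<mu> \<ge> 0\<close> that vanishes on \<open>K\<close> and is large on
  \<open>closure U - Q\<close>.  Put \<open>V = {\<rho> > \<mu> \<ell>}\<close> with an affine function \<open>\<ell>\<close> close to \<open>1\<close>.  Where
  \<open>\<mu> = 0\<close>, the frontier of \<open>V\<close> is contained in that of \<open>U\<close>, the derivative of \<open>\<mu>\<close> vanishes, and that
  of \<open>\<rho>\<close> does not.  Where \<open>\<mu> > 0\<close>, a degenerate zero of \<open>\<rho> - \<mu> \<ell>\<close> is a point where \<open>\<ell>\<close> is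
  the tangent affine function of \<open>\<rho> / \<mu>\<close>.  The tangent affine functions form the image of a
  \<open>C\<^sup>1\<close> map from dimension \<open>n\<close> to dimension \<open>n + 1\<close>, which is a null set, so almost every \<open>\<ell>\<close> is good
  (\<open>generic_affine_perturbation\<close>).

  Finally a superlevel set of a function that is regular on the frontier is a smooth domain
  (\<open>regular_superlevel_set_smooth_domain\<close>): near a frontier point the function is altered away from that point
  so as to be strictly increasing in one direction on the whole space, and then its zero set is a
  global graph (\<open>zero_set_is_graph\<close>).
\<close>

section \<open>Local Hoelder regularity up to second order\<close>

text \<open>
  Global Hoelder bounds are not stable under products, bounds on every ball are.  All constructions
  are therefore carried out in the local classes, and a global bound is recovered only at the end,
  for functions with enough invariance (\<open>loc_Holder_imp_Holder\<close>).
\<close>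

definition loc_Holder :: "real \<Rightarrow> ('a::euclidean_space \<Rightarrow> real) \<Rightarrow> bool" where
  "loc_Holder \<alpha> g \<longleftrightarrow>
     (\<forall>R. \<exists>C. \<forall>x\<in>cball 0 R. \<forall>y\<in>cball 0 R. \<bar>g x - g y\<bar> \<le> C * dist x y powr \<alpha>)"

text \<open>
  The derivative is tested on each fixed direction, as in \<open>Ck\<close> and \<open>C2_Holder\<close>; this reduces
  all closure properties to those of real-valued functions.
\<close>

definition loc_C1_Holder :: "real \<Rightarrow> ('a::euclidean_space \<Rightarrow> real) \<Rightarrow> bool" where
  "loc_C1_Holder \<alpha> g \<longleftrightarrow>
     (\<exists>g'. (\<forall>x. (g has_derivative g' x) (at x)) \<and> (\<forall>v. loc_Holder \<alpha> (\<lambda>x. g' x v)))"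

definition loc_C2_Holder :: "real \<Rightarrow> ('a::euclidean_space \<Rightarrow> real) \<Rightarrow> bool" where
  "loc_C2_Holder \<alpha> g \<longleftrightarrow>
     (\<exists>g'. (\<forall>x. (g has_derivative g' x) (at x)) \<and> (\<forall>v. loc_C1_Holder \<alpha> (\<lambda>x. g' x v)))"

lemma loc_HolderE:
  fixes g :: "'a::euclidean_space \<Rightarrow> real"
  assumes "loc_Holder \<alpha> g"
  obtains C where "C \<ge> 0"
    "\<And>x y. x \<in> cball 0 R \<Longrightarrow> y \<in> cball 0 R \<Longrightarrow> \<bar>g x - g y\<bar> \<le> C * dist x y powr \<alpha>"
proof -
  obtain C where C: "\<And>x y. x \<in> cball 0 R \<Longrightarrow> y \<in> cball 0 R \<Longrightarrow> \<bar>g x - g y\<bar> \<le> C * dist x y powr \<alpha>"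
    using assms unfolding loc_Holder_def by meson
  show thesis
  proof (rule that[of "\<bar>C\<bar>"])
    fix x y :: 'a assume "x \<in> cball 0 R" "y \<in> cball 0 R"
    then have "\<bar>g x - g y\<bar> \<le> C * dist x y powr \<alpha>" by (rule C)
    also have "\<dots> \<le> \<bar>C\<bar> * dist x y powr \<alpha>" by (intro mult_right_mono) auto
    finally show "\<bar>g x - g y\<bar> \<le> \<bar>C\<bar> * dist x y powr \<alpha>" .
  qed simp
qed

text \<open>
  Continuity in each direction suffices, since the operator norm is controlled by the values on the
  finitely many basis vectors.
\<close>

lemma derivative_continuous_imp_lipschitz_on_cball:
  fixes g :: "'a::euclidean_space \<Rightarrow> real"
  assumes der: "\<And>x. (g has_derivative g' x) (at x)"
    and cont: "\<And>v. continuous_on UNIV (\<lambda>x. g' x v)"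
  obtains B where "B-lipschitz_on (cball 0 R) g"
proof -
  have "\<exists>B. \<forall>x\<in>cball 0 R. \<bar>g' x b\<bar> \<le> B" for b
  proof -
    have "compact ((\<lambda>x. g' x b) ` cball 0 R)"
      by (intro compact_continuous_image continuous_on_subset[OF cont]) auto
    then show ?thesis
      using compact_imp_bounded[of "(\<lambda>x. g' x b) ` cball 0 R"] unfolding bounded_iff by auto
  qed
  then obtain B where B: "\<And>b x. x \<in> cball 0 R \<Longrightarrow> \<bar>g' x b\<bar> \<le> B b" by metis
  let ?C = "\<Sum>b\<in>Basis. \<bar>B b\<bar>"
  have "?C-lipschitz_on (cball 0 R) g"
  proof (rule bounded_derivative_imp_lipschitz)
    fix x :: 'a assume x: "x \<in> cball 0 R"
    show "(g has_derivative g' x) (at x within cball 0 R)"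
      using der by (rule has_derivative_at_withinI)
    interpret bounded_linear "g' x" using der by (rule has_derivative_bounded_linear)
    show "onorm (g' x) \<le> ?C"
    proof (rule onorm_bound)
      fix v
      have "g' x v = g' x (\<Sum>b\<in>Basis. (v \<bullet> b) *\<^sub>R b)" by (simp add: euclidean_representation)
      also have "\<dots> = (\<Sum>b\<in>Basis. (v \<bullet> b) * g' x b)" by (simp add: sum scaleR)
      also have "norm \<dots> \<le> (\<Sum>b\<in>Basis. \<bar>B b\<bar> * norm v)"
      proof (rule sum_norm_le)
        fix b :: 'a assume b: "b \<in> Basis"
        have "\<bar>v \<bullet> b\<bar> * \<bar>g' x b\<bar> \<le> norm v * \<bar>B b\<bar>"
          using B[OF x, of b] Basis_le_norm[OF b, of v] by (intro mult_mono) auto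
        then show "norm ((v \<bullet> b) * g' x b) \<le> \<bar>B b\<bar> * norm v"
          by (simp add: abs_mult mult.commute)
      qed
      finally show "norm (g' x v) \<le> ?C * norm v" by (simp add: sum_distrib_right)
    qed (simp add: sum_nonneg)
  qed (auto simp: sum_nonneg)
  then show thesis by (rule that)
qed

lemma loc_C2_Holder_derivative:
  assumes "loc_C2_Holder \<alpha> f" and der: "\<And>x. (f has_derivative f' x) (at x)"
  shows "loc_C1_Holder \<alpha> (\<lambda>x. f' x v)"
proof -
  obtain g' where g': "\<And>x. (f has_derivative g' x) (at x)" "\<And>v. loc_C1_Holder \<alpha> (\<lambda>x. g' x v)"
    using assms(1) unfolding loc_C2_Holder_def by blast
  have "g' = f'" using has_derivative_unique[OF g'(1) der] by auto
  then show ?thesis using g'(2) by simp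
qed

context
  fixes \<alpha> :: real
  assumes \<alpha>: "0 < \<alpha>" "\<alpha> < 1"
begin

lemma loc_Holder_bounded:
  assumes "loc_Holder \<alpha> g"
  obtains B where "B \<ge> 0" "\<And>x. x \<in> cball 0 R \<Longrightarrow> \<bar>g x\<bar> \<le> B"
proof -
  obtain C where C: "C \<ge> 0"
    "\<And>x y. x \<in> cball 0 R \<Longrightarrow> y \<in> cball 0 R \<Longrightarrow> \<bar>g x - g y\<bar> \<le> C * dist x y powr \<alpha>"
    using loc_HolderE[OF assms] by blast
  show thesis
  proof (rule that[of "\<bar>g 0\<bar> + C * R powr \<alpha>"])
    fix x :: 'a assume x: "x \<in> cball 0 R"
    then have "0 \<le> R" using order_trans[OF norm_ge_zero] by (auto simp: dist_norm)
    then have "\<bar>g x - g 0\<bar> \<le> C * dist x 0 powr \<alpha>" using C(2)[of x 0] x by simp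
    also have "\<dots> \<le> C * R powr \<alpha>"
      using x \<alpha> C(1) by (intro mult_left_mono powr_mono2) (auto simp: dist_commute)
    finally show "\<bar>g x\<bar> \<le> \<bar>g 0\<bar> + C * R powr \<alpha>" by linarith
  qed (use C in auto)
qed

lemma loc_Holder_lipschitz:
  assumes "\<And>R. \<exists>B. B-lipschitz_on (cball 0 R) g"
  shows "loc_Holder \<alpha> g"
  unfolding loc_Holder_def
proof
  fix R
  obtain B where B: "B-lipschitz_on (cball 0 R) g" using assms by blast
  have B0: "B \<ge> 0" using B by (rule lipschitz_on_nonneg)
  show "\<exists>C. \<forall>x\<in>cball 0 R. \<forall>y\<in>cball 0 R. \<bar>g x - g y\<bar> \<le> C * dist x y powr \<alpha>"
  proof (intro exI ballI)
    fix x y :: 'a assume xy: "x \<in> cball 0 R" "y \<in> cball 0 R"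
    have d: "dist x y \<le> 2 * R" using xy dist_triangle[of x y 0] by (auto simp: dist_commute)
    have "\<bar>g x - g y\<bar> \<le> B * dist x y" using lipschitz_onD[OF B xy] by (simp add: dist_real_def)
    also have "dist x y = dist x y powr (1 - \<alpha>) * dist x y powr \<alpha>"
      by (simp add: powr_add[symmetric])
    also have "B * \<dots> \<le> B * ((2 * R) powr (1 - \<alpha>) * dist x y powr \<alpha>)"
      using d \<alpha> B0 by (intro mult_left_mono mult_right_mono powr_mono2) auto
    finally show "\<bar>g x - g y\<bar> \<le> B * (2 * R) powr (1 - \<alpha>) * dist x y powr \<alpha>"
      by (simp add: mult.assoc)
  qed
qed

lemma loc_Holder_continuous:
  assumes "loc_Holder \<alpha> g"
  shows "continuous_on UNIV g"
proof -
  have "isCont g x" for x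
  proof -
    obtain C where C: "C \<ge> 0"
      "\<And>y z. y \<in> cball 0 (norm x + 1) \<Longrightarrow> z \<in> cball 0 (norm x + 1) \<Longrightarrow> \<bar>g y - g z\<bar> \<le> C * dist y z powr \<alpha>"
      using loc_HolderE[OF assms] by blast
    have *: "eventually (\<lambda>y. norm (g y - g x) \<le> C * dist y x powr \<alpha>) (at x)"
      unfolding eventually_at
    proof (intro exI[of _ 1] conjI ballI impI)
      fix y assume "y \<noteq> x \<and> dist y x < 1"
      then have "norm y \<le> norm x + 1" using norm_triangle_ineq2[of y x] by (auto simp: dist_norm)
      then show "norm (g y - g x) \<le> C * dist y x powr \<alpha>" using C(2)[of y x] by simp
    qed simp
    have "((\<lambda>y. C * dist y x powr \<alpha>) \<longlongrightarrow> C * dist x x powr \<alpha>) (at x)"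
      using \<alpha> by (intro tendsto_intros) auto
    then have "((\<lambda>y. C * dist y x powr \<alpha>) \<longlongrightarrow> 0) (at x)" using \<alpha> by simp
    then have "((\<lambda>y. g y - g x) \<longlongrightarrow> 0) (at x)" by (rule Lim_null_comparison[OF *])
    then show ?thesis unfolding isCont_def by (simp add: LIM_zero_iff)
  qed
  then show ?thesis by (simp add: continuous_on_eq_continuous_at)
qed

lemma loc_Holder_const [intro]: "loc_Holder \<alpha> (\<lambda>x. c)"
  by (auto simp: loc_Holder_def intro!: exI[of _ 0])

lemma loc_Holder_add [intro]:
  assumes "loc_Holder \<alpha> f" "loc_Holder \<alpha> g"
  shows "loc_Holder \<alpha> (\<lambda>x. f x + g x)"
  unfolding loc_Holder_def
proof
  fix R
  obtain C where C: "\<And>x y. x \<in> cball 0 R \<Longrightarrow> y \<in> cball 0 R \<Longrightarrow> \<bar>f x - f y\<bar> \<le> C * dist x y powr \<alpha>"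
    using loc_HolderE[OF assms(1)] by blast
  obtain D where D: "\<And>x y. x \<in> cball 0 R \<Longrightarrow> y \<in> cball 0 R \<Longrightarrow> \<bar>g x - g y\<bar> \<le> D * dist x y powr \<alpha>"
    using loc_HolderE[OF assms(2)] by blast
  show "\<exists>C. \<forall>x\<in>cball 0 R. \<forall>y\<in>cball 0 R. \<bar>f x + g x - (f y + g y)\<bar> \<le> C * dist x y powr \<alpha>"
  proof (intro exI ballI)
    fix x y :: 'a assume "x \<in> cball 0 R" "y \<in> cball 0 R"
    from C[OF this] D[OF this]
    show "\<bar>f x + g x - (f y + g y)\<bar> \<le> (C + D) * dist x y powr \<alpha>" by (simp add: algebra_simps)
  qed
qed

lemma loc_Holder_mult [intro]:
  assumes "loc_Holder \<alpha> f" "loc_Holder \<alpha> g"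
  shows "loc_Holder \<alpha> (\<lambda>x. f x * g x)"
  unfolding loc_Holder_def
proof
  fix R
  obtain C where C: "C \<ge> 0" "\<And>x y. x \<in> cball 0 R \<Longrightarrow> y \<in> cball 0 R \<Longrightarrow> \<bar>f x - f y\<bar> \<le> C * dist x y powr \<alpha>"
    using loc_HolderE[OF assms(1)] by blast
  obtain D where D: "D \<ge> 0" "\<And>x y. x \<in> cball 0 R \<Longrightarrow> y \<in> cball 0 R \<Longrightarrow> \<bar>g x - g y\<bar> \<le> D * dist x y powr \<alpha>"
    using loc_HolderE[OF assms(2)] by blast
  obtain A where A: "A \<ge> 0" "\<And>x. x \<in> cball 0 R \<Longrightarrow> \<bar>f x\<bar> \<le> A"
    using loc_Holder_bounded[OF assms(1)] by blast
  obtain B where B: "B \<ge> 0" "\<And>x. x \<in> cball 0 R \<Longrightarrow> \<bar>g x\<bar> \<le> B"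
    using loc_Holder_bounded[OF assms(2)] by blast
  show "\<exists>C. \<forall>x\<in>cball 0 R. \<forall>y\<in>cball 0 R. \<bar>f x * g x - f y * g y\<bar> \<le> C * dist x y powr \<alpha>"
  proof (intro exI ballI)
    fix x y :: 'a assume xy: "x \<in> cball 0 R" "y \<in> cball 0 R"
    have "f x * g x - f y * g y = f x * (g x - g y) + g y * (f x - f y)" by (simp add: algebra_simps)
    also have "\<bar>\<dots>\<bar> \<le> \<bar>f x\<bar> * \<bar>g x - g y\<bar> + \<bar>g y\<bar> * \<bar>f x - f y\<bar>"
      by (metis abs_mult abs_triangle_ineq)
    also have "\<dots> \<le> A * (D * dist x y powr \<alpha>) + B * (C * dist x y powr \<alpha>)"
      using A B C D xy by (intro add_mono mult_mono) auto
    finally show "\<bar>f x * g x - f y * g y\<bar> \<le> (A * D + B * C) * dist x y powr \<alpha>"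
      by (simp add: algebra_simps)
  qed
qed

lemma loc_Holder_inverse:
  assumes "loc_Holder \<alpha> f" "c > 0" "\<And>x. f x \<ge> c"
  shows "loc_Holder \<alpha> (\<lambda>x. inverse (f x))"
  unfolding loc_Holder_def
proof
  fix R
  obtain C where C: "C \<ge> 0" "\<And>x y. x \<in> cball 0 R \<Longrightarrow> y \<in> cball 0 R \<Longrightarrow> \<bar>f x - f y\<bar> \<le> C * dist x y powr \<alpha>"
    using loc_HolderE[OF assms(1)] by blast
  show "\<exists>C. \<forall>x\<in>cball 0 R. \<forall>y\<in>cball 0 R. \<bar>inverse (f x) - inverse (f y)\<bar> \<le> C * dist x y powr \<alpha>"
  proof (intro exI ballI)
    fix x y :: 'a assume xy: "x \<in> cball 0 R" "y \<in> cball 0 R"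
    have p: "f x > 0" "f y > 0" using assms(2) assms(3)[of x] assms(3)[of y] by linarith+
    have cc: "c * c \<le> f x * f y" using assms(2,3) p by (intro mult_mono) auto
    have "inverse (f x) - inverse (f y) = (f y - f x) / (f x * f y)"
      using p by (simp add: field_simps)
    also have "\<bar>\<dots>\<bar> = \<bar>f x - f y\<bar> / (f x * f y)"
      using p by (simp add: abs_minus_commute)
    also have "\<dots> \<le> (C * dist x y powr \<alpha>) / (c * c)"
      using C xy cc assms(2) by (intro frac_le) auto
    finally show "\<bar>inverse (f x) - inverse (f y)\<bar> \<le> (C / (c * c)) * dist x y powr \<alpha>"
      by simp
  qed
qed

lemma loc_Holder_compose:
  fixes P :: "'a::euclidean_space \<Rightarrow> 'b::euclidean_space"
  assumes "loc_Holder \<alpha> f" and P: "\<And>R. \<exists>B. B-lipschitz_on (cball 0 R) P"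
  shows "loc_Holder \<alpha> (\<lambda>x. f (P x))"
  unfolding loc_Holder_def
proof
  fix R
  obtain B where B: "B-lipschitz_on (cball 0 R) P" using P by blast
  have B0: "B \<ge> 0" using B by (rule lipschitz_on_nonneg)
  obtain C where C: "C \<ge> 0" "\<And>x y. x \<in> cball 0 (norm (P 0) + B * R) \<Longrightarrow> y \<in> cball 0 (norm (P 0) + B * R)
      \<Longrightarrow> \<bar>f x - f y\<bar> \<le> C * dist x y powr \<alpha>"
    using loc_HolderE[OF assms(1)] by blast
  have PR: "P x \<in> cball 0 (norm (P 0) + B * R)" if x: "x \<in> cball 0 R" for x
  proof -
    have "0 \<le> R" using x order_trans[OF norm_ge_zero] by auto
    then have "dist (P x) (P 0) \<le> B * dist x 0" using lipschitz_onD[OF B x, of 0] by auto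
    also have "\<dots> \<le> B * R" using x B0 by (intro mult_left_mono) auto
    finally show ?thesis using norm_triangle_ineq2[of "P x" "P 0"] by (simp add: dist_norm)
  qed
  show "\<exists>C. \<forall>x\<in>cball 0 R. \<forall>y\<in>cball 0 R. \<bar>f (P x) - f (P y)\<bar> \<le> C * dist x y powr \<alpha>"
  proof (intro exI ballI)
    fix x y :: 'a assume xy: "x \<in> cball 0 R" "y \<in> cball 0 R"
    have "\<bar>f (P x) - f (P y)\<bar> \<le> C * dist (P x) (P y) powr \<alpha>" using C(2) PR xy by blast
    also have "\<dots> \<le> C * (B * dist x y) powr \<alpha>"
      using lipschitz_onD[OF B xy] C(1) \<alpha> by (intro mult_left_mono powr_mono2) auto
    also have "\<dots> = (C * B powr \<alpha>) * dist x y powr \<alpha>" using B0 by (simp add: powr_mult)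
    finally show "\<bar>f (P x) - f (P y)\<bar> \<le> (C * B powr \<alpha>) * dist x y powr \<alpha>" .
  qed
qed

lemma loc_C1_Holder_lipschitz:
  assumes "loc_C1_Holder \<alpha> g"
  shows "\<exists>B. B-lipschitz_on (cball 0 R) g"
proof -
  obtain g' where "\<And>x. (g has_derivative g' x) (at x)" "\<And>v. loc_Holder \<alpha> (\<lambda>x. g' x v)"
    using assms unfolding loc_C1_Holder_def by blast
  then show ?thesis
    using derivative_continuous_imp_lipschitz_on_cball loc_Holder_continuous by metis
qed

lemma loc_C1_Holder_imp_loc_Holder: "loc_C1_Holder \<alpha> g \<Longrightarrow> loc_Holder \<alpha> g"
  by (intro loc_Holder_lipschitz loc_C1_Holder_lipschitz)

lemma loc_C2_Holder_imp_loc_C1_Holder: "loc_C2_Holder \<alpha> g \<Longrightarrow> loc_C1_Holder \<alpha> g"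
  unfolding loc_C1_Holder_def[of _ g] loc_C2_Holder_def
  using loc_C1_Holder_imp_loc_Holder by blast

lemma loc_C1_Holder_const [intro]: "loc_C1_Holder \<alpha> (\<lambda>x. c)"
  unfolding loc_C1_Holder_def by (intro exI[of _ "\<lambda>x v. 0"]) auto

lemma loc_C2_Holder_const [intro]: "loc_C2_Holder \<alpha> (\<lambda>x. c)"
  unfolding loc_C2_Holder_def by (intro exI[of _ "\<lambda>x v. 0"]) auto

lemma loc_C1_Holder_add [intro]:
  assumes "loc_C1_Holder \<alpha> f" "loc_C1_Holder \<alpha> g"
  shows "loc_C1_Holder \<alpha> (\<lambda>x. f x + g x)"
proof -
  obtain f' where "\<And>x. (f has_derivative f' x) (at x)" "\<And>v. loc_Holder \<alpha> (\<lambda>x. f' x v)"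
    using assms unfolding loc_C1_Holder_def by blast
  moreover obtain g' where "\<And>x. (g has_derivative g' x) (at x)" "\<And>v. loc_Holder \<alpha> (\<lambda>x. g' x v)"
    using assms unfolding loc_C1_Holder_def by blast
  ultimately show ?thesis
    unfolding loc_C1_Holder_def
    by (intro exI[of _ "\<lambda>x v. f' x v + g' x v"]) (auto intro!: has_derivative_add)
qed

lemma loc_C2_Holder_add [intro]:
  assumes "loc_C2_Holder \<alpha> f" "loc_C2_Holder \<alpha> g"
  shows "loc_C2_Holder \<alpha> (\<lambda>x. f x + g x)"
proof -
  obtain f' where "\<And>x. (f has_derivative f' x) (at x)" "\<And>v. loc_C1_Holder \<alpha> (\<lambda>x. f' x v)"
    using assms unfolding loc_C2_Holder_def by blast
  moreover obtain g' where "\<And>x. (g has_derivative g' x) (at x)" "\<And>v. loc_C1_Holder \<alpha> (\<lambda>x. g' x v)"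
    using assms unfolding loc_C2_Holder_def by blast
  ultimately show ?thesis
    unfolding loc_C2_Holder_def
    by (intro exI[of _ "\<lambda>x v. f' x v + g' x v"]) (auto intro!: has_derivative_add)
qed

lemma loc_C1_Holder_mult [intro]:
  assumes "loc_C1_Holder \<alpha> f" "loc_C1_Holder \<alpha> g"
  shows "loc_C1_Holder \<alpha> (\<lambda>x. f x * g x)"
proof -
  obtain f' where f': "\<And>x. (f has_derivative f' x) (at x)" "\<And>v. loc_Holder \<alpha> (\<lambda>x. f' x v)"
    using assms unfolding loc_C1_Holder_def by blast
  obtain g' where g': "\<And>x. (g has_derivative g' x) (at x)" "\<And>v. loc_Holder \<alpha> (\<lambda>x. g' x v)"
    using assms unfolding loc_C1_Holder_def by blast
  have "loc_Holder \<alpha> (\<lambda>x. f x * g' x v + f' x v * g x)" for v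
    by (intro loc_Holder_add loc_Holder_mult f' g' assms[THEN loc_C1_Holder_imp_loc_Holder])
  then show ?thesis
    unfolding loc_C1_Holder_def using has_derivative_mult[OF f'(1) g'(1)]
    by (intro exI[of _ "\<lambda>x v. f x * g' x v + f' x v * g x"]) auto
qed

lemma loc_C2_Holder_mult [intro]:
  assumes "loc_C2_Holder \<alpha> f" "loc_C2_Holder \<alpha> g"
  shows "loc_C2_Holder \<alpha> (\<lambda>x. f x * g x)"
proof -
  obtain f' where f': "\<And>x. (f has_derivative f' x) (at x)" "\<And>v. loc_C1_Holder \<alpha> (\<lambda>x. f' x v)"
    using assms unfolding loc_C2_Holder_def by blast
  obtain g' where g': "\<And>x. (g has_derivative g' x) (at x)" "\<And>v. loc_C1_Holder \<alpha> (\<lambda>x. g' x v)"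
    using assms unfolding loc_C2_Holder_def by blast
  have "loc_C1_Holder \<alpha> (\<lambda>x. f x * g' x v + f' x v * g x)" for v
    by (intro loc_C1_Holder_add loc_C1_Holder_mult f' g' assms[THEN loc_C2_Holder_imp_loc_C1_Holder])
  then show ?thesis
    unfolding loc_C2_Holder_def using has_derivative_mult[OF f'(1) g'(1)]
    by (intro exI[of _ "\<lambda>x v. f x * g' x v + f' x v * g x"]) auto
qed

lemma loc_C2_Holder_diff [intro]:
  assumes "loc_C2_Holder \<alpha> f" "loc_C2_Holder \<alpha> g"
  shows "loc_C2_Holder \<alpha> (\<lambda>x. f x - g x)"
proof -
  have "loc_C2_Holder \<alpha> (\<lambda>x. f x + (-1) * g x)"
    by (intro loc_C2_Holder_add loc_C2_Holder_mult loc_C2_Holder_const assms)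
  then show ?thesis by simp
qed

lemma loc_C2_Holder_sum:
  assumes "\<And>i. i \<in> I \<Longrightarrow> loc_C2_Holder \<alpha> (f i)"
  shows "loc_C2_Holder \<alpha> (\<lambda>x. \<Sum>i\<in>I. f i x)"
  using assms by (induction I rule: infinite_finite_induct) auto

lemma loc_C1_Holder_inverse:
  assumes "loc_C1_Holder \<alpha> f" "c > 0" "\<And>x. f x \<ge> c"
  shows "loc_C1_Holder \<alpha> (\<lambda>x. inverse (f x))"
proof -
  obtain f' where f': "\<And>x. (f has_derivative f' x) (at x)" "\<And>v. loc_Holder \<alpha> (\<lambda>x. f' x v)"
    using assms unfolding loc_C1_Holder_def by blast
  have nz: "f x \<noteq> 0" for x using assms(2) assms(3)[of x] by linarith
  have "((\<lambda>x. inverse (f x)) has_derivative (\<lambda>v. (-1) * (inverse (f x) * f' x v * inverse (f x)))) (at x)" for x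
    using Deriv.has_derivative_inverse[OF nz f'(1)] by simp
  moreover have "loc_Holder \<alpha> (\<lambda>x. (-1) * (inverse (f x) * f' x v * inverse (f x)))" for v
    by (intro loc_Holder_mult loc_Holder_const f'(2)
        loc_Holder_inverse[OF loc_C1_Holder_imp_loc_Holder[OF assms(1)] assms(2,3)])
  ultimately show ?thesis
    unfolding loc_C1_Holder_def
    by (intro exI[of _ "\<lambda>x v. (-1) * (inverse (f x) * f' x v * inverse (f x))"]) auto
qed

lemma loc_C1_Holder_inner: "loc_C1_Holder \<alpha> (\<lambda>x. a \<bullet> x)"
  unfolding loc_C1_Holder_def
  by (intro exI[of _ "\<lambda>x v. a \<bullet> v"]) (auto intro!: derivative_eq_intros)

lemma loc_C2_Holder_inner [intro]: "loc_C2_Holder \<alpha> (\<lambda>x. a \<bullet> x)"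
  unfolding loc_C2_Holder_def
  by (intro exI[of _ "\<lambda>x v. a \<bullet> v"]) (auto intro!: derivative_eq_intros)

lemma loc_C2_Holder_dist2 [intro]: "loc_C2_Holder \<alpha> (\<lambda>x. (dist x p)\<^sup>2)"
proof -
  have "((\<lambda>x. (dist x p)\<^sup>2) has_derivative (\<lambda>v. (2 *\<^sub>R v) \<bullet> x + (-2) * (v \<bullet> p))) (at x)" for x
    by (auto simp: dist_norm power2_norm_eq_inner inner_commute algebra_simps
        intro!: derivative_eq_intros)
  moreover have "loc_C1_Holder \<alpha> (\<lambda>x. (2 *\<^sub>R v) \<bullet> x + (-2) * (v \<bullet> p))" for v
    by (intro loc_C1_Holder_add loc_C1_Holder_const loc_C1_Holder_inner)
  ultimately show ?thesis
    unfolding loc_C2_Holder_def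
    by (intro exI[of _ "\<lambda>x v. (2 *\<^sub>R v) \<bullet> x + (-2) * (v \<bullet> p)"]) blast
qed

end

lemma has_field_derivative_pos_part_power:
  assumes "n \<ge> 1"
  shows "((\<lambda>s::real. max 0 s ^ Suc n) has_field_derivative real (Suc n) * max 0 s ^ n) (at s)"
proof (cases s "0::real" rule: linorder_cases)
  case less
  have "((\<lambda>s. 0) has_field_derivative 0) (at s)" by simp
  then have "((\<lambda>s::real. max 0 s ^ Suc n) has_field_derivative 0) (at s)"
    by (rule has_field_derivative_transform_within_open[of _ _ _ "{..<0}"]) (use less in auto)
  moreover have "real (Suc n) * max 0 s ^ n = 0" using less assms by simp
  ultimately show ?thesis by (simp only:)
next
  case equal
  have "(\<lambda>h::real. max 0 h ^ n) \<midarrow>0\<rightarrow> max 0 0 ^ n" by (intro tendsto_intros)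
  moreover have "max 0 0 ^ n = (0::real)" using assms by simp
  ultimately have lim: "(\<lambda>h::real. max 0 h ^ n) \<midarrow>0\<rightarrow> 0" by (simp only:)
  have "\<forall>\<^sub>F h in at 0. norm (max 0 h ^ Suc n / h) \<le> max 0 (h::real) ^ n"
    by (rule eventuallyI) (auto simp: max_def)
  then have "(\<lambda>h::real. max 0 h ^ Suc n / h) \<midarrow>0\<rightarrow> 0"
    using lim by (rule Lim_null_comparison)
  moreover have z: "real (Suc n) * max 0 s ^ n = 0" using equal assms by simp
  ultimately show ?thesis unfolding DERIV_def z using equal by simp
next
  case greater
  have "((\<lambda>s. s ^ Suc n) has_field_derivative real (Suc n) * s ^ n) (at s)"
    using DERIV_pow[of "Suc n" s] by simp
  then have "((\<lambda>s::real. max 0 s ^ Suc n) has_field_derivative real (Suc n) * s ^ n) (at s)"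
    by (rule has_field_derivative_transform_within_open[of _ _ _ "{0<..}"]) (use greater in auto)
  moreover have "max 0 s = s" using greater by simp
  ultimately show ?thesis by (simp only:)
qed

lemma has_derivative_pos_part_power:
  assumes "(q has_derivative q') (at x)" "n \<ge> 1"
  shows "((\<lambda>x. max 0 (q x :: real) ^ Suc n) has_derivative (\<lambda>v. real (Suc n) * max 0 (q x) ^ n * q' v)) (at x)"
proof -
  have "((\<lambda>s. max 0 s ^ Suc n) has_derivative (\<lambda>v. real (Suc n) * max 0 (q x) ^ n * v)) (at (q x))"
    using has_field_derivative_pos_part_power[OF assms(2), of "q x"]
    by (simp only: has_field_derivative_def)
  from has_derivative_compose[OF assms(1) this] show ?thesis .
qed

text \<open>
  The cube of the positive part is the simplest cut-off profile with a Lipschitz second derivative.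
\<close>

lemma loc_C2_Holder_pos_part_cube:
  fixes q :: "'a::euclidean_space \<Rightarrow> real"
  assumes \<alpha>: "0 < \<alpha>" "\<alpha> < 1" and q: "loc_C2_Holder \<alpha> q"
  shows "loc_C2_Holder \<alpha> (\<lambda>x. max 0 (q x) ^ 3)"
proof -
  obtain q' where q': "\<And>x. (q has_derivative q' x) (at x)" "\<And>v. loc_C1_Holder \<alpha> (\<lambda>x. q' x v)"
    using q unfolding loc_C2_Holder_def by blast
  have "\<exists>B. B-lipschitz_on (cball 0 R) (\<lambda>x. max 0 (q x))" for R
  proof -
    obtain B where "B-lipschitz_on (cball 0 R) q"
      using loc_C1_Holder_lipschitz[OF \<alpha> loc_C2_Holder_imp_loc_C1_Holder[OF \<alpha> q]] by blast
    then have "B-lipschitz_on (cball 0 R) (\<lambda>x. max 0 (q x))"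
      unfolding lipschitz_on_def
    proof (elim conjE, intro conjI ballI)
      fix x y :: 'a assume "\<forall>x\<in>cball 0 R. \<forall>y\<in>cball 0 R. dist (q x) (q y) \<le> B * dist x y"
        and "x \<in> cball 0 R" "y \<in> cball 0 R"
      then have "dist (q x) (q y) \<le> B * dist x y" by blast
      moreover have "dist (max 0 (q x)) (max 0 (q y)) \<le> dist (q x) (q y)"
        by (auto simp: dist_real_def max_def)
      ultimately show "dist (max 0 (q x)) (max 0 (q y)) \<le> B * dist x y" by linarith
    qed
    then show ?thesis by blast
  qed
  then have H: "loc_Holder \<alpha> (\<lambda>x. max 0 (q x))" by (rule loc_Holder_lipschitz[OF \<alpha>])
  have "loc_Holder \<alpha> (\<lambda>x. 2 * (max 0 (q x)) * q' x v)" for v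
    by (intro loc_Holder_mult[OF \<alpha>] loc_Holder_const[OF \<alpha>] H loc_C1_Holder_imp_loc_Holder[OF \<alpha>] q'(2))
  then have C1: "loc_C1_Holder \<alpha> (\<lambda>x. max 0 (q x) ^ 2)"
    unfolding loc_C1_Holder_def
    using has_derivative_pos_part_power[OF q'(1), of 1]
    by (intro exI[of _ "\<lambda>x v. 2 * max 0 (q x) * q' x v"]) (auto simp: power2_eq_square)
  have "loc_C1_Holder \<alpha> (\<lambda>x. 3 * (max 0 (q x))^2 * q' x v)" for v
    by (intro C1 q'(2) loc_C1_Holder_mult[OF \<alpha>] loc_C1_Holder_const[OF \<alpha>])
  then show ?thesis
    unfolding loc_C2_Holder_def
    using has_derivative_pos_part_power[OF q'(1), of 2]
    by (intro exI[of _ "\<lambda>x v. 3 * (max 0 (q x))\<^sup>2 * q' x v"]) (auto simp: power2_eq_square power3_eq_cube mult.assoc)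
qed


section \<open>Zero sets that are graphs\<close>

text \<open>
  The map \<open>p\<close> stands for the projection along the axis of a graph.  A point in the support and a point at
  distance less than \<open>1\<close> from it both project into a fixed ball; at larger distances boundedness suffices.
\<close>

lemma loc_Holder_imp_Holder:
  fixes D :: "'a::euclidean_space \<Rightarrow> real"
  assumes \<alpha>: "0 < \<alpha>" "\<alpha> < 1" and D: "loc_Holder \<alpha> D"
    and factor: "\<And>x. D x = D (p x)" and contr: "\<And>x y. dist (p x) (p y) \<le> dist x y"
    and supp: "\<And>x. norm (p x) > R \<Longrightarrow> D x = 0"
  shows "\<exists>C. \<forall>x y. \<bar>D x - D y\<bar> \<le> C * dist x y powr \<alpha>"
proof -
  obtain C where C: "C \<ge> 0" "\<And>x y. x \<in> cball 0 (R + 1) \<Longrightarrow> y \<in> cball 0 (R + 1) \<Longrightarrow>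
      \<bar>D x - D y\<bar> \<le> C * dist x y powr \<alpha>"
    using loc_HolderE[OF D] by blast
  obtain B where B: "B \<ge> 0" "\<And>x. x \<in> cball 0 (R + 1) \<Longrightarrow> \<bar>D x\<bar> \<le> B"
    using loc_Holder_bounded[OF \<alpha> D] by blast
  have far: "\<bar>D x - D y\<bar> \<le> (C + B) * dist x y powr \<alpha>" if y: "norm (p y) > R + 1" for x y
  proof (cases "norm (p x) > R")
    case True
    then show ?thesis using supp[of x] supp[of y] y C(1) B(1) by simp
  next
    case False
    have "1 \<le> dist (p x) (p y)"
      using False y norm_triangle_ineq2[of "p y" "p x"] by (simp add: dist_norm norm_minus_commute)
    then have "1 \<le> dist x y" using contr[of x y] by linarith
    then have "1 \<le> dist x y powr \<alpha>" using \<alpha> by (simp add: ge_one_powr_ge_zero)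
    then have "B * 1 \<le> (C + B) * dist x y powr \<alpha>" using B(1) C(1) by (intro mult_mono) auto
    moreover have "\<bar>D x\<bar> \<le> B" using B(2)[of "p x"] factor[of x] False by simp
    moreover have "D y = 0" using supp[of y] y by simp
    ultimately show ?thesis by simp
  qed
  have "\<bar>D x - D y\<bar> \<le> (C + B) * dist x y powr \<alpha>" for x y
  proof (cases "norm (p x) > R + 1 \<or> norm (p y) > R + 1")
    case True
    then show ?thesis using far[of x y] far[of y x] by (metis abs_minus_commute dist_commute)
  next
    case False
    then have "\<bar>D (p x) - D (p y)\<bar> \<le> C * dist (p x) (p y) powr \<alpha>" by (intro C(2)) auto
    also have "\<dots> \<le> (C + B) * dist x y powr \<alpha>"
      using contr[of x y] C(1) B(1) \<alpha> by (intro mult_mono powr_mono2) auto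
    finally show ?thesis using factor[of x] factor[of y] by simp
  qed
  then show ?thesis by blast
qed

lemma frechet_derivative_eqI:
  "(f has_derivative f') (at x) \<Longrightarrow> frechet_derivative f (at x) = f'"
  using frechet_derivative_at by metis

lemma frechet_derivative_translation_invariant:
  assumes "\<And>x. f (x + c) = f x" and "f differentiable (at x)"
  shows "frechet_derivative f (at (x + c)) = frechet_derivative f (at x)"
proof -
  have "(f has_derivative frechet_derivative f (at x)) (at x)"
    using assms(2) frechet_derivative_works by blast
  moreover have "((\<lambda>y. y - c) has_derivative (\<lambda>h. h)) (at (x + c))"
    by (auto intro!: derivative_eq_intros)
  ultimately have "((\<lambda>y. f (y - c)) has_derivative frechet_derivative f (at x)) (at (x + c))"
    using has_derivative_compose[of "\<lambda>y. y - c" "\<lambda>h. h" "x + c" UNIV f] by simp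
  moreover have "f (y - c) = f y" for y using assms(1)[of "y - c"] by simp
  ultimately show ?thesis by (simp add: frechet_derivative_eqI)
qed

lemma frechet_derivative_const_on_open:
  assumes "open W" "x \<in> W" "\<And>y. y \<in> W \<Longrightarrow> f y = c"
  shows "frechet_derivative f (at x) = (\<lambda>v. 0)"
  by (rule frechet_derivative_eqI, rule has_derivative_transform_within_open[OF _ assms(1,2)])
     (use assms(3) in auto)

text \<open>
  A nonzero function that is invariant in the direction \<open>e\<close> never has compact support, but its second
  derivatives have it modulo \<open>e\<close>, which is what makes the Hoelder bound global.
\<close>

lemma loc_C2_Holder_imp_C2_Holder:
  fixes f :: "'a::euclidean_space \<Rightarrow> real"
  assumes \<alpha>: "0 < \<alpha>" "\<alpha> < 1" and f: "loc_C2_Holder \<alpha> f"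
    and e: "norm e = 1" and inv: "\<And>x s. f (x + s *\<^sub>R e) = f x"
    and const: "\<And>x. norm (x - (x \<bullet> e) *\<^sub>R e) > R \<Longrightarrow> f x = c"
  shows "C2_Holder \<alpha> f"
proof -
  define p where "p = (\<lambda>x::'a. x - (x \<bullet> e) *\<^sub>R e)"
  have p_lin: "p x - p y = p (x - y)" for x y by (simp add: p_def algebra_simps)
  have p_norm: "norm (p x) \<le> norm x" for x
  proof -
    have "e \<bullet> e = 1" using e by (simp add: dot_square_norm)
    then have "(norm (p x))\<^sup>2 = (norm x)\<^sup>2 - (x \<bullet> e)\<^sup>2"
      unfolding p_def power2_norm_eq_inner
      by (simp add: algebra_simps inner_commute power2_eq_square)
    then have "(norm (p x))\<^sup>2 \<le> (norm x)\<^sup>2" by simp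
    then show ?thesis by (rule power2_le_imp_le) simp
  qed
  have p_contr: "dist (p x) (p y) \<le> dist x y" for x y
    using p_norm[of "x - y"] by (simp add: dist_norm p_lin)
  have p_shift: "p x = x + (- (x \<bullet> e)) *\<^sub>R e" for x by (simp add: p_def)
  define W where "W = {x. norm (p x) > R}"
  have "open W" unfolding W_def p_def by (intro open_Collect_less continuous_intros)
  obtain f' where f': "\<And>x. (f has_derivative f' x) (at x)" "\<And>v. loc_C1_Holder \<alpha> (\<lambda>x. f' x v)"
    using f unfolding loc_C2_Holder_def by blast
  have fd: "frechet_derivative f (at x) = f' x" for x by (rule frechet_derivative_eqI[OF f'(1)])
  have f'_inv: "f' (x + s *\<^sub>R e) = f' x" for x s
    using frechet_derivative_translation_invariant[of f "s *\<^sub>R e" x] inv f'(1) fd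
    by (auto simp: differentiable_def)
  have f'_0: "f' x = (\<lambda>v. 0)" if "x \<in> W" for x
    using frechet_derivative_const_on_open[OF \<open>open W\<close> that, of f c] const
    by (auto simp: W_def p_def fd)
  define D where "D v w x = frechet_derivative (\<lambda>y. f' y v) (at x) w" for v w x
  have D: "\<And>x. (\<lambda>x. f' x v) differentiable (at x)" "loc_Holder \<alpha> (D v w)" for v w
  proof -
    obtain f'' where f'': "\<And>x. ((\<lambda>x. f' x v) has_derivative f'' x) (at x)"
      "\<And>w. loc_Holder \<alpha> (\<lambda>x. f'' x w)"
      using f'(2) unfolding loc_C1_Holder_def by blast
    show "(\<lambda>x. f' x v) differentiable (at x)" for x using f''(1) unfolding differentiable_def by blast
    show "loc_Holder \<alpha> (D v w)" unfolding D_def frechet_derivative_eqI[OF f''(1)] by (rule f''(2))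
  qed
  have D_inv: "D v w x = D v w (p x)" for v w x
    unfolding p_shift D_def
    using frechet_derivative_translation_invariant[of "\<lambda>y. f' y v" "(- (x \<bullet> e)) *\<^sub>R e" x] f'_inv D(1)
    by (simp del: scaleR_minus_left)
  have D_0: "D v w x = 0" if "norm (p x) > R" for v w x
    using frechet_derivative_const_on_open[OF \<open>open W\<close>, of x "\<lambda>y. f' y v" 0] f'_0 that
    by (auto simp: W_def D_def)
  have "\<exists>C. \<forall>x y. \<bar>D v w x - D v w y\<bar> \<le> C * dist x y powr \<alpha>" for v w
    by (rule loc_Holder_imp_Holder[OF \<alpha> D(2) D_inv p_contr D_0])
  moreover have "Ck 2 f"
    using D(1) loc_Holder_continuous[OF \<alpha> D(2)] differentiableI[OF f'(1)]
    unfolding numeral_2_eq_2 D_def by (auto simp: fd)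
  ultimately show ?thesis
    unfolding C2_Holder_def by (simp add: Let_def fd D_def)
qed

lemma C2_Holder_imp_loc_C2_Holder:
  assumes "C2_Holder \<alpha> f"
  shows "loc_C2_Holder \<alpha> f"
proof -
  let ?f' = "\<lambda>x. frechet_derivative f (at x)"
  let ?f'' = "\<lambda>v x. frechet_derivative (\<lambda>y. ?f' y v) (at x)"
  have "\<And>x. f differentiable (at x)" "\<And>v x. (\<lambda>x. ?f' x v) differentiable (at x)"
    using assms unfolding C2_Holder_def by (auto simp: numeral_2_eq_2)
  then have "\<And>x. (f has_derivative ?f' x) (at x)"
    "\<And>v x. ((\<lambda>x. ?f' x v) has_derivative ?f'' v x) (at x)"
    using frechet_derivative_works by blast+
  moreover have "loc_Holder \<alpha> (\<lambda>x. ?f'' v x w)" for v w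
    using assms unfolding C2_Holder_def loc_Holder_def Let_def by blast
  ultimately show ?thesis
    unfolding loc_C2_Holder_def loc_C1_Holder_def
    by (intro exI[of _ ?f'] conjI allI exI[of _ "?f'' v" for v])
qed

text \<open>
  A global implicit function theorem.  The uniform slope \<open>N\<close> gives existence and uniqueness of the
  zero on each line parallel to \<open>e\<close>, and it bounds the distance of any height from the zero by \<open>1 / N\<close>
  times the value of \<open>\<Phi>\<close> there.  Applied to the height predicted by the linearization, this bound
  yields the derivative of the graph function.
\<close>

lemma zero_set_is_graph:
  fixes \<Phi> :: "'a::euclidean_space \<Rightarrow> real"
  assumes \<alpha>: "0 < \<alpha>" "\<alpha> < 1" and C2: "loc_C2_Holder \<alpha> \<Phi>"
    and e: "norm e = 1" and N: "N > 0"
    and der: "\<And>x. (\<Phi> has_derivative \<Phi>' x) (at x)" and slope: "\<And>x. \<Phi>' x e \<ge> N"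
    and far: "\<And>x. dist x x0 \<ge> r \<Longrightarrow> \<Phi> x = M * ((x - x0) \<bullet> e)"
  obtains f where "C2_Holder \<alpha> f" "\<And>x s. f (x + s *\<^sub>R e) = f x"
    "\<And>x. \<Phi> x > 0 \<longleftrightarrow> f x < x \<bullet> e"
proof -
  have ee: "e \<bullet> e = 1" using e by (simp add: dot_square_norm)
  have steep: "\<Phi> (x + t *\<^sub>R e) - \<Phi> (x + s *\<^sub>R e) \<ge> N * (t - s)" if "s \<le> t" for x s t
  proof -
    have "\<Phi> (x + s *\<^sub>R e) - N * s \<le> \<Phi> (x + t *\<^sub>R e) - N * t"
    proof (rule DERIV_nonneg_imp_nondecreasing[OF that])
      fix \<sigma>
      have "((\<lambda>\<sigma>. x + \<sigma> *\<^sub>R e) has_derivative (\<lambda>h. h *\<^sub>R e)) (at \<sigma>)"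
        by (auto intro!: derivative_eq_intros)
      from has_derivative_compose[OF this der]
      have "((\<lambda>\<sigma>. \<Phi> (x + \<sigma> *\<^sub>R e)) has_derivative (\<lambda>h. h * \<Phi>' (x + \<sigma> *\<^sub>R e) e)) (at \<sigma>)"
        using has_derivative_linear[OF der] by (simp add: linear_cmul)
      then have "((\<lambda>\<sigma>. \<Phi> (x + \<sigma> *\<^sub>R e)) has_field_derivative \<Phi>' (x + \<sigma> *\<^sub>R e) e) (at \<sigma>)"
        by (simp add: has_field_derivative_def mult_commute_abs)
      then have "((\<lambda>\<sigma>. \<Phi> (x + \<sigma> *\<^sub>R e) - N * \<sigma>) has_field_derivative \<Phi>' (x + \<sigma> *\<^sub>R e) e - N) (at \<sigma>)"
        by (auto intro!: derivative_eq_intros)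
      then show "\<exists>y. ((\<lambda>\<sigma>. \<Phi> (x + \<sigma> *\<^sub>R e) - N * \<sigma>) has_field_derivative y) (at \<sigma>) \<and> 0 \<le> y"
        using slope by fastforce
    qed
    then show ?thesis by (simp add: algebra_simps)
  qed
  have contF: "continuous_on UNIV \<Phi>"
    using der has_derivative_continuous by (metis continuous_at_imp_continuous_on)
  \<comment> \<open>The point at height \<open>\<tau>\<close> on the line through \<open>x\<close>.\<close>
  define Y where "Y x \<tau> = x + (\<tau> - x \<bullet> e) *\<^sub>R e" for x \<tau>
  have "\<exists>\<tau>. \<Phi> (Y x \<tau>) = 0" for x
  proof -
    let ?b = "\<bar>\<Phi> x\<bar> / N"
    have b: "?b \<ge> 0" using N by simp
    have "\<Phi> (x + ?b *\<^sub>R e) \<ge> 0" "\<Phi> (x + (-?b) *\<^sub>R e) \<le> 0"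
      using steep[of 0 ?b x] steep[of "-?b" 0 x] b N by (auto simp del: scaleR_minus_left)
    then obtain s where "\<Phi> (x + s *\<^sub>R e) = 0"
      using IVT'[of "\<lambda>s. \<Phi> (x + s *\<^sub>R e)" "-?b" 0 ?b] b
        continuous_on_compose2[OF contF, of "{-?b..?b}" "\<lambda>s. x + s *\<^sub>R e"]
      by (force intro: continuous_intros)
    then have "\<Phi> (Y x (s + x \<bullet> e)) = 0" by (simp add: Y_def)
    then show ?thesis by blast
  qed
  then obtain f where f: "\<And>x. \<Phi> (Y x (f x)) = 0" by metis
  have gap: "N * \<bar>\<tau> - f x\<bar> \<le> \<bar>\<Phi> (Y x \<tau>)\<bar>" for x \<tau>
    using steep[of "\<tau> - x \<bullet> e" "f x - x \<bullet> e" x] steep[of "f x - x \<bullet> e" "\<tau> - x \<bullet> e" x] f[of x]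
    by (cases "\<tau> \<le> f x") (auto simp: Y_def algebra_simps)
  have uniq: "f x = \<tau>" if "\<Phi> (Y x \<tau>) = 0" for x \<tau>
    using gap[of \<tau> x] that N by (simp add: mult_le_0_iff)
  have inv: "f (x + s *\<^sub>R e) = f x" for x s
  proof (rule uniq)
    have "Y (x + s *\<^sub>R e) (f x) = Y x (f x)" by (simp add: Y_def algebra_simps ee)
    then show "\<Phi> (Y (x + s *\<^sub>R e) (f x)) = 0" using f by simp
  qed
  have sign: "\<Phi> x > 0 \<longleftrightarrow> f x < x \<bullet> e" for x
  proof -
    have 0: "\<Phi> (x + (f x - x \<bullet> e) *\<^sub>R e) = 0" using f[of x] by (simp add: Y_def)
    show ?thesis
    proof (cases "f x < x \<bullet> e")
      case True
      then have "0 < N * (x \<bullet> e - f x)" using N by simp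
      then show ?thesis using steep[of "f x - x \<bullet> e" 0 x] 0 True by simp
    next
      case False
      then have "0 \<le> N * (f x - x \<bullet> e)" using N by simp
      then show ?thesis using steep[of 0 "f x - x \<bullet> e" x] 0 False by simp
    qed
  qed
  \<comment> \<open>Off a cylinder around the axis through \<open>x0\<close> the graph is the hyperplane through \<open>x0\<close>.\<close>
  have flat: "f x = x0 \<bullet> e" if "norm (x - (x \<bullet> e) *\<^sub>R e) > r + norm (x0 - (x0 \<bullet> e) *\<^sub>R e)" for x
  proof (rule uniq)
    have eq: "Y x (x0 \<bullet> e) - x0 = (x - (x \<bullet> e) *\<^sub>R e) - (x0 - (x0 \<bullet> e) *\<^sub>R e)"
      by (simp add: Y_def algebra_simps)
    have "dist (Y x (x0 \<bullet> e)) x0 \<ge> r"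
      unfolding dist_norm eq
      using that norm_triangle_ineq2[of "x - (x \<bullet> e) *\<^sub>R e" "x0 - (x0 \<bullet> e) *\<^sub>R e"] by linarith
    moreover have "(Y x (x0 \<bullet> e) - x0) \<bullet> e = 0"
      by (simp add: Y_def inner_diff_left inner_add_left ee)
    ultimately show "\<Phi> (Y x (x0 \<bullet> e)) = 0" by (simp only: far mult_zero_right)
  qed
  define P where "P x = Y x (f x)" for x
  define f' where "f' x v = - \<Phi>' (P x) (v - (v \<bullet> e) *\<^sub>R e) / \<Phi>' (P x) e" for x v
  have nz: "\<Phi>' x e \<noteq> 0" for x using slope[of x] N by auto
  have lin: "linear (\<Phi>' x)" for x by (rule has_derivative_linear[OF der])
  have f'_bl: "bounded_linear (f' x)" for x
  proof -
    have "linear (f' x)"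
    proof (rule linearI)
      fix a b :: 'a and c :: real
      have "a + b - ((a + b) \<bullet> e) *\<^sub>R e = (a - (a \<bullet> e) *\<^sub>R e) + (b - (b \<bullet> e) *\<^sub>R e)"
        by (simp add: algebra_simps)
      then show "f' x (a + b) = f' x a + f' x b"
        unfolding f'_def by (simp only: linear_add[OF lin] minus_add_distrib add_divide_distrib)
      have "c *\<^sub>R a - ((c *\<^sub>R a) \<bullet> e) *\<^sub>R e = c *\<^sub>R (a - (a \<bullet> e) *\<^sub>R e)"
        by (simp add: algebra_simps)
      then show "f' x (c *\<^sub>R a) = c *\<^sub>R f' x a"
        unfolding f'_def by (simp only: linear_cmul[OF lin]) simp
    qed
    then show ?thesis by (simp add: linear_conv_bounded_linear)
  qed
  have f_der: "(f has_derivative f' x) (at x)" for x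
  proof -
    \<comment> \<open>The value of \<open>\<Phi>\<close> at the height predicted by \<open>f'\<close>; by \<open>gap\<close> it controls the prediction error.\<close>
    define \<Psi> where "\<Psi> y = \<Phi> (Y y (f x + f' x (y - x)))" for y
    have 1: "((\<lambda>y. Y y (f x + f' x (y - x))) has_derivative
        (\<lambda>v. v + (f' x v - v \<bullet> e) *\<^sub>R e)) (at x)"
      unfolding Y_def
      by (auto intro!: derivative_eq_intros bounded_linear.has_derivative[OF f'_bl])
    have 2: "Y x (f x + f' x (x - x)) = P x"
      using linear_0[OF bounded_linear.linear[OF f'_bl]] by (simp add: P_def)
    have "(\<Psi> has_derivative (\<lambda>v. \<Phi>' (P x) (v + (f' x v - v \<bullet> e) *\<^sub>R e))) (at x)"
      unfolding \<Psi>_def by (rule has_derivative_compose[OF 1]) (simp only: 2 der)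
    moreover have "\<Phi>' (P x) (v + (f' x v - v \<bullet> e) *\<^sub>R e) = 0" for v
    proof -
      have eq: "v + (f' x v - v \<bullet> e) *\<^sub>R e = (v - (v \<bullet> e) *\<^sub>R e) + f' x v *\<^sub>R e"
        by (simp add: algebra_simps)
      show ?thesis
        unfolding eq linear_add[OF lin] linear_cmul[OF lin] using nz[of "P x"] by (simp add: f'_def)
    qed
    ultimately have "(\<Psi> has_derivative (\<lambda>v. 0)) (at x)" by simp
    then have "((\<lambda>y. norm (\<Psi> y - \<Psi> x - 0) / norm (y - x)) \<longlongrightarrow> 0) (at x)"
      unfolding has_derivative_iff_norm by blast
    then have lim: "((\<lambda>y. (1 / N) * (norm (\<Psi> y - \<Psi> x - 0) / norm (y - x))) \<longlongrightarrow> 0) (at x)"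
      by (rule tendsto_mult_right_zero)
    have \<Psi>x: "\<Psi> x = 0"
      using f[of x] linear_0[OF bounded_linear.linear[OF f'_bl]] by (simp add: \<Psi>_def)
    show ?thesis
    proof (rule has_derivativeI_sandwich[OF zero_less_one f'_bl _ lim])
      fix y assume "y \<noteq> x"
      have "N * \<bar>f x + f' x (y - x) - f y\<bar> \<le> \<bar>\<Psi> y\<bar>" unfolding \<Psi>_def by (rule gap)
      moreover have "\<bar>f x + f' x (y - x) - f y\<bar> = \<bar>f y - f x - f' x (y - x)\<bar>" by linarith
      ultimately have "\<bar>f y - f x - f' x (y - x)\<bar> \<le> (1 / N) * \<bar>\<Psi> y\<bar>"
        using N by (simp add: pos_le_divide_eq mult.commute)
      then have "\<bar>f y - f x - f' x (y - x)\<bar> / norm (y - x) \<le> ((1 / N) * \<bar>\<Psi> y\<bar>) / norm (y - x)"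
        by (rule divide_right_mono) simp
      then show "norm (f y - f x - f' x (y - x)) / norm (y - x)
          \<le> (1 / N) * (norm (\<Psi> y - \<Psi> x - 0) / norm (y - x))" by (simp add: \<Psi>x)
    qed
  qed
  have P_der: "(P has_derivative (\<lambda>v. (v - (v \<bullet> e) *\<^sub>R e) + f' x v *\<^sub>R e)) (at x)" for x
    unfolding P_def Y_def by (auto intro!: derivative_eq_intros f_der simp: algebra_simps)
  have \<Phi>'_C1: "loc_C1_Holder \<alpha> (\<lambda>x. \<Phi>' x v)" for v by (rule loc_C2_Holder_derivative[OF C2 der])
  have \<Phi>'_cont: "continuous_on UNIV (\<lambda>x. \<Phi>' x v)" for v
    by (rule loc_Holder_continuous[OF \<alpha> loc_C1_Holder_imp_loc_Holder[OF \<alpha> \<Phi>'_C1]])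
  have "continuous_on UNIV P"
    using P_der has_derivative_continuous by (metis continuous_at_imp_continuous_on)
  then have "continuous_on UNIV (\<lambda>x. f' x v)" for v
    unfolding f'_def using nz
    by (intro continuous_intros continuous_on_compose2[OF \<Phi>'_cont]) auto
  then have f_lip: "\<exists>B. B-lipschitz_on (cball 0 R) f" for R
    using derivative_continuous_imp_lipschitz_on_cball[OF f_der] by blast
  have P_lip: "\<exists>B. B-lipschitz_on (cball 0 R) P" for R
  proof -
    obtain B where "B-lipschitz_on (cball 0 R) f" using f_lip by blast
    moreover obtain A where "A-lipschitz_on (cball 0 R) (\<lambda>x. x \<bullet> e)"
      using loc_C1_Holder_lipschitz[OF \<alpha> loc_C1_Holder_inner[OF \<alpha>, of e]] by (auto simp: inner_commute)
    ultimately have "(B + A)-lipschitz_on (cball 0 R) (\<lambda>x. f x - x \<bullet> e)"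
      by (rule lipschitz_on_diff)
    moreover have "dist (a *\<^sub>R e) (b *\<^sub>R e) = dist a b" for a b
      by (simp add: dist_norm e flip: scaleR_diff_left)
    ultimately have "(B + A)-lipschitz_on (cball 0 R) (\<lambda>x. (f x - x \<bullet> e) *\<^sub>R e)"
      by (simp add: lipschitz_on_def)
    then have "(1 + (B + A))-lipschitz_on (cball 0 R) P"
      unfolding P_def Y_def by (intro lipschitz_on_add lipschitz_on_id)
    then show ?thesis by blast
  qed
  have comp0: "loc_Holder \<alpha> (\<lambda>x. \<Phi>' (P x) v)" for v
    by (rule loc_Holder_compose[OF \<alpha> loc_C1_Holder_imp_loc_Holder[OF \<alpha> \<Phi>'_C1] P_lip])
  have f'_eq: "f' x v = (-1) * \<Phi>' (P x) (v - (v \<bullet> e) *\<^sub>R e) * inverse (\<Phi>' (P x) e)" for x v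
    by (simp add: f'_def divide_inverse)
  have f'_H: "loc_Holder \<alpha> (\<lambda>x. f' x v)" for v
    unfolding f'_eq
    by (intro loc_Holder_mult[OF \<alpha>] loc_Holder_const[OF \<alpha>] comp0 loc_Holder_inverse[OF \<alpha> comp0 N] slope)
  have comp1: "loc_C1_Holder \<alpha> (\<lambda>x. \<Phi>' (P x) v)" for v
  proof -
    obtain \<Phi>'' where \<Phi>'': "\<And>x. ((\<lambda>x. \<Phi>' x v) has_derivative \<Phi>'' x) (at x)"
      "\<And>w. loc_Holder \<alpha> (\<lambda>x. \<Phi>'' x w)"
      using \<Phi>'_C1 unfolding loc_C1_Holder_def by blast
    have l: "linear (\<Phi>'' x)" for x by (rule has_derivative_linear[OF \<Phi>''(1)])
    have "((\<lambda>x. \<Phi>' (P x) v) has_derivative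
        (\<lambda>w. \<Phi>'' (P x) (w - (w \<bullet> e) *\<^sub>R e) + f' x w * \<Phi>'' (P x) e)) (at x)" for x
      using has_derivative_compose[OF P_der \<Phi>''(1)] by (simp add: linear_add[OF l] linear_cmul[OF l])
    moreover have "loc_Holder \<alpha> (\<lambda>x. \<Phi>'' (P x) (w - (w \<bullet> e) *\<^sub>R e) + f' x w * \<Phi>'' (P x) e)" for w
      by (intro loc_Holder_add[OF \<alpha>] loc_Holder_mult[OF \<alpha>] f'_H
          loc_Holder_compose[OF \<alpha> \<Phi>''(2) P_lip])
    ultimately show ?thesis
      unfolding loc_C1_Holder_def
      by (intro exI[of _ "\<lambda>x w. \<Phi>'' (P x) (w - (w \<bullet> e) *\<^sub>R e) + f' x w * \<Phi>'' (P x) e"]) blast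
  qed
  have "loc_C1_Holder \<alpha> (\<lambda>x. f' x v)" for v
    unfolding f'_eq
    by (intro loc_C1_Holder_mult[OF \<alpha>] loc_C1_Holder_const[OF \<alpha>] comp1
        loc_C1_Holder_inverse[OF \<alpha> comp1 N] slope)
  then have "loc_C2_Holder \<alpha> f" unfolding loc_C2_Holder_def using f_der by blast
  then have "C2_Holder \<alpha> f"
    by (rule loc_C2_Holder_imp_C2_Holder[where e = e
          and R = "r + norm (x0 - (x0 \<bullet> e) *\<^sub>R e)" and c = "x0 \<bullet> e", OF \<alpha> _ e inv flat])
  then show thesis using inv sign that by blast
qed


section \<open>Regular superlevel sets are smooth domains\<close>

text \<open>
  The explicit bound on the derivative matters: it decides how much the slope can change when a function is
  glued to its linearization on a ball of radius \<open>r\<close>.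
\<close>

lemma smooth_cutoff:
  fixes x0 :: "'a::euclidean_space"
  assumes \<alpha>: "0 < \<alpha>" "\<alpha> < 1" and r: "r > 0"
  obtains \<kappa> \<kappa>' where "loc_C2_Holder \<alpha> \<kappa>" "\<And>x. (\<kappa> has_derivative \<kappa>' x) (at x)"
    "\<And>x. 0 \<le> \<kappa> x" "\<And>x. \<kappa> x \<le> 1" "\<And>x. dist x x0 < r / 4 \<Longrightarrow> \<kappa> x = 1"
    "\<And>x. dist x x0 \<ge> r \<Longrightarrow> \<kappa> x = 0" "\<And>x v. dist x x0 \<ge> r \<Longrightarrow> \<kappa>' x v = 0"
    "\<And>x v. \<bar>\<kappa>' x v\<bar> \<le> 36 / r * norm v"
proof -
  define a where "a x = 1 - (1 / r\<^sup>2) * (dist x x0)\<^sup>2" for x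
  define b where "b x = 1 - 2 * max 0 (a x) ^ 3" for x
  define \<kappa> where "\<kappa> x = 1 - max 0 (b x) ^ 3" for x
  define a' where "a' x v = - (1 / r\<^sup>2) * (2 * ((x - x0) \<bullet> v))" for x v
  define b' where "b' x v = - 6 * (max 0 (a x))\<^sup>2 * a' x v" for x v
  define \<kappa>' where "\<kappa>' x v = - 3 * (max 0 (b x))\<^sup>2 * b' x v" for x v
  have "loc_C2_Holder \<alpha> a" unfolding a_def[abs_def]
    by (intro loc_C2_Holder_diff[OF \<alpha>] loc_C2_Holder_mult[OF \<alpha>] loc_C2_Holder_const[OF \<alpha>]
        loc_C2_Holder_dist2[OF \<alpha>])
  then have "loc_C2_Holder \<alpha> b" unfolding b_def[abs_def]
    by (intro loc_C2_Holder_diff[OF \<alpha>] loc_C2_Holder_mult[OF \<alpha>] loc_C2_Holder_const[OF \<alpha>]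
        loc_C2_Holder_pos_part_cube[OF \<alpha>])
  then have C2: "loc_C2_Holder \<alpha> \<kappa>" unfolding \<kappa>_def[abs_def]
    by (intro loc_C2_Holder_diff[OF \<alpha>] loc_C2_Holder_const[OF \<alpha>] loc_C2_Holder_pos_part_cube[OF \<alpha>])
  have "((\<lambda>x. 1 - c * ((x - x0) \<bullet> (x - x0))) has_derivative (\<lambda>v. - c * (2 * ((x - x0) \<bullet> v)))) (at x)"
    for x c by (auto intro!: derivative_eq_intros simp: inner_commute algebra_simps)
  then have a_der: "(a has_derivative a' x) (at x)" for x
    unfolding a_def[abs_def] a'_def[abs_def] dist_norm power2_norm_eq_inner .
  have cube: "((\<lambda>x. max 0 (q x) ^ 3) has_derivative (\<lambda>v. 3 * (max 0 (q x))\<^sup>2 * q' v)) (at x)"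
    if "(q has_derivative q') (at x)" for q :: "'a \<Rightarrow> real" and q' x
    using has_derivative_pos_part_power[OF that, of 2] by (simp add: numeral_3_eq_3 numeral_2_eq_2)
  have b_der: "(b has_derivative b' x) (at x)" for x
  proof -
    have "((\<lambda>x. 1 - 2 * max 0 (a x) ^ 3) has_derivative (\<lambda>v. 0 - 2 * (3 * (max 0 (a x))\<^sup>2 * a' x v))) (at x)"
      by (rule has_derivative_diff[OF has_derivative_const has_derivative_mult_right[OF cube[OF a_der]]])
    then show ?thesis by (simp add: b_def[abs_def] b'_def[abs_def] mult.assoc)
  qed
  have \<kappa>_der: "(\<kappa> has_derivative \<kappa>' x) (at x)" for x
  proof -
    have "((\<lambda>x. 1 - max 0 (b x) ^ 3) has_derivative (\<lambda>v. 0 - 3 * (max 0 (b x))\<^sup>2 * b' x v)) (at x)"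
      by (rule has_derivative_diff[OF has_derivative_const cube[OF b_der]])
    then show ?thesis by (simp add: \<kappa>_def[abs_def] \<kappa>'_def[abs_def])
  qed
  have a_le: "max 0 (a x) \<le> 1" for x unfolding a_def by simp
  have b_le: "max 0 (b x) \<le> 1" for x unfolding b_def by simp
  have a_0: "max 0 (a x) = 0" if "dist x x0 \<ge> r" for x
  proof -
    have "(dist x x0)\<^sup>2 \<ge> r\<^sup>2" using that r by (intro power_mono) auto
    then show ?thesis using r by (simp add: a_def field_simps)
  qed
  show thesis
  proof (rule that[OF C2 \<kappa>_der])
    fix x
    show "0 \<le> \<kappa> x" using power_le_one[of "max 0 (b x)" 3] b_le[of x] by (simp add: \<kappa>_def)
    show "\<kappa> x \<le> 1" by (simp add: \<kappa>_def)
    show "\<kappa> x = 1" if d: "dist x x0 < r / 4"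
    proof -
      have "(dist x x0)\<^sup>2 \<le> (r / 4)\<^sup>2" using d by (intro power_mono) auto
      then have "(1 / r\<^sup>2) * (dist x x0)\<^sup>2 \<le> 1 / 16"
        using r by (simp add: power_divide field_simps)
      then have "a x \<ge> 15 / 16" unfolding a_def by linarith
      then have "max 0 (a x) \<ge> 15 / 16" by simp
      then have "max 0 (a x) ^ 3 \<ge> (15 / 16) ^ 3" by (intro power_mono) auto
      then have "b x \<le> 0" unfolding b_def by (simp add: power3_eq_cube)
      then show ?thesis by (simp add: \<kappa>_def)
    qed
    show "\<kappa> x = 0" if "dist x x0 \<ge> r" using a_0[OF that] by (simp add: \<kappa>_def b_def)
    fix v
    show zero: "\<kappa>' x v = 0" if "dist x x0 \<ge> r" using a_0[OF that] by (simp add: \<kappa>'_def b'_def)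
    show "\<bar>\<kappa>' x v\<bar> \<le> 36 / r * norm v"
    proof (cases "dist x x0 \<ge> r")
      case True
      then show ?thesis using zero r by simp
    next
      case False
      have "\<bar>\<kappa>' x v\<bar> = 18 * (max 0 (b x))\<^sup>2 * (max 0 (a x))\<^sup>2 * \<bar>a' x v\<bar>"
        by (simp add: \<kappa>'_def b'_def abs_mult)
      also have "\<dots> \<le> 18 * 1 * 1 * \<bar>a' x v\<bar>"
        using a_le[of x] b_le[of x] by (intro mult_mono power_le_one) auto
      also have "\<bar>a' x v\<bar> = (2 / r\<^sup>2) * \<bar>(x - x0) \<bullet> v\<bar>" by (simp add: a'_def abs_mult)
      also have "\<dots> \<le> (2 / r\<^sup>2) * (r * norm v)"
      proof (rule mult_left_mono)
        have "\<bar>(x - x0) \<bullet> v\<bar> \<le> norm (x - x0) * norm v" by (rule Cauchy_Schwarz_ineq2)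
        also have "\<dots> \<le> r * norm v" using False by (intro mult_right_mono) (auto simp: dist_norm)
        finally show "\<bar>(x - x0) \<bullet> v\<bar> \<le> r * norm v" .
      qed simp
      finally show ?thesis using r by (simp add: power2_eq_square field_simps)
    qed
  qed
qed

text \<open>
  Glue \<open>F\<close> to its linearization at \<open>x0\<close>.  On a ball of radius \<open>r\<close> they differ by at most \<open>\<omega> r\<close> with small \<open>\<omega>\<close>,
  and the cut-off has slope at most \<open>36 / r\<close>, so the slope in the direction of the gradient changes by at most \<open>37 \<omega>\<close>,
  however small \<open>r\<close> is.
\<close>

lemma straighten_at_regular_point:
  fixes F :: "'a::euclidean_space \<Rightarrow> real"
  assumes \<alpha>: "0 < \<alpha>" "\<alpha> < 1" and C2: "loc_C2_Holder \<alpha> F"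
    and der: "\<And>x. (F has_derivative F' x) (at x)"
    and zero: "F x0 = 0" and regular: "F' x0 \<noteq> (\<lambda>v. 0)"
  obtains \<Phi> e M r \<Phi>' where "loc_C2_Holder \<alpha> \<Phi>" "norm e = 1" "M > 0" "r > 0"
    "\<And>x. (\<Phi> has_derivative \<Phi>' x) (at x)" "\<And>x. \<Phi>' x e \<ge> M / 2"
    "\<And>x. dist x x0 \<ge> r \<Longrightarrow> \<Phi> x = M * ((x - x0) \<bullet> e)"
    "\<And>x. dist x x0 < r / 4 \<Longrightarrow> \<Phi> x = F x"
proof -
  have lin: "linear (F' x)" for x using der by (rule has_derivative_linear)
  define G where "G = adjoint (F' x0) 1"
  have G: "F' x0 v = v \<bullet> G" for v using adjoint_works[OF lin, of v x0 1] by (simp add: G_def)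
  define M where "M = norm G"
  define e where "e = G /\<^sub>R M"
  have "G \<noteq> 0" using regular G by auto
  then have M: "M > 0" and e: "norm e = 1" by (auto simp: M_def e_def)
  have F'0: "F' x0 v = M * (v \<bullet> e)" for v using M by (simp add: G e_def)
  define L where "L x = M * ((x - x0) \<bullet> e)" for x
  \<comment> \<open>\<open>74 = 2 * 37\<close>, so that a slope error of \<open>37 \<omega>\<close> is half of the slope \<open>M\<close>.\<close>
  define \<omega> where "\<omega> = M / 74"
  have \<omega>: "\<omega> > 0" using M by (simp add: \<omega>_def)
  have "continuous_on UNIV (\<lambda>x. F' x e)"
    by (intro loc_Holder_continuous[OF \<alpha>] loc_C1_Holder_imp_loc_Holder[OF \<alpha>]
        loc_C2_Holder_derivative[OF C2 der])
  then obtain d1 where d1: "d1 > 0" "\<And>x. dist x x0 < d1 \<Longrightarrow> \<bar>F' x e - F' x0 e\<bar> < \<omega>"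
    using \<omega> unfolding continuous_on_iff dist_real_def by (metis UNIV_I)
  obtain d2 where d2: "d2 > 0"
    "\<And>y. norm (y - x0) < d2 \<Longrightarrow> norm (F y - F x0 - F' x0 (y - x0)) \<le> \<omega> * norm (y - x0)"
    using der[of x0] \<omega> unfolding has_derivative_at_alt by blast
  define r where "r = min d1 d2"
  have r: "r > 0" using d1 d2 by (simp add: r_def)
  have FL: "\<bar>F x - L x\<bar> \<le> \<omega> * r" if "dist x x0 < r" for x
  proof -
    have "\<bar>F x - L x\<bar> \<le> \<omega> * norm (x - x0)"
      using d2(2)[of x] that by (simp add: zero F'0 L_def r_def dist_norm)
    also have "\<dots> \<le> \<omega> * r" using that \<omega> by (intro mult_left_mono) (auto simp: dist_norm)
    finally show ?thesis .
  qed
  have ee: "e \<bullet> e = 1" using e by (simp add: dot_square_norm)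
  obtain \<kappa> \<kappa>' where \<kappa>: "loc_C2_Holder \<alpha> \<kappa>" "\<And>x. (\<kappa> has_derivative \<kappa>' x) (at x)"
    "\<And>x. 0 \<le> \<kappa> x" "\<And>x. \<kappa> x \<le> 1" "\<And>x. dist x x0 < r / 4 \<Longrightarrow> \<kappa> x = 1"
    "\<And>x. dist x x0 \<ge> r \<Longrightarrow> \<kappa> x = 0" "\<And>x v. dist x x0 \<ge> r \<Longrightarrow> \<kappa>' x v = 0"
    "\<And>x v. \<bar>\<kappa>' x v\<bar> \<le> 36 / r * norm v"
    using smooth_cutoff[OF \<alpha> r, of x0] by blast
  have L_eq: "L x = (M *\<^sub>R e) \<bullet> x + (- M * (x0 \<bullet> e))" for x
    by (simp add: L_def inner_diff_left inner_commute algebra_simps)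
  have L_C2: "loc_C2_Holder \<alpha> L"
    unfolding L_eq[abs_def]
    by (intro loc_C2_Holder_add[OF \<alpha>] loc_C2_Holder_inner[OF \<alpha>] loc_C2_Holder_const[OF \<alpha>])
  have L_der: "(L has_derivative (\<lambda>v. M * (v \<bullet> e))) (at x)" for x
    unfolding L_def[abs_def] by (auto intro!: derivative_eq_intros)
  define \<Phi> where "\<Phi> x = L x + \<kappa> x * (F x - L x)" for x
  define \<Phi>' where "\<Phi>' x v = M * (v \<bullet> e) + (\<kappa> x * (F' x v - M * (v \<bullet> e)) + \<kappa>' x v * (F x - L x))" for x v
  show thesis
  proof (rule that[of \<Phi> e M r \<Phi>'])
    show "loc_C2_Holder \<alpha> \<Phi>" unfolding \<Phi>_def[abs_def]
      by (intro loc_C2_Holder_add[OF \<alpha>] loc_C2_Holder_mult[OF \<alpha>] loc_C2_Holder_diff[OF \<alpha>] L_C2 \<kappa>(1) C2)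
    fix x
    show "(\<Phi> has_derivative \<Phi>' x) (at x)"
      unfolding \<Phi>_def[abs_def] \<Phi>'_def[abs_def]
      by (intro has_derivative_add has_derivative_mult has_derivative_diff L_der \<kappa>(2) der)
    show "\<Phi>' x e \<ge> M / 2"
    proof (cases "dist x x0 \<ge> r")
      case True
      then show ?thesis using \<kappa>(6,7) M by (simp add: \<Phi>'_def ee)
    next
      case False
      then have d: "dist x x0 < r" by simp
      have "\<bar>F' x e - M\<bar> \<le> \<omega>" using d1(2)[of x] d by (simp add: r_def F'0 ee)
      then have "\<bar>\<kappa> x * (F' x e - M)\<bar> \<le> 1 * \<omega>"
        using \<kappa>(3,4)[of x] unfolding abs_mult by (intro mult_mono) auto
      moreover have "\<bar>\<kappa>' x e * (F x - L x)\<bar> \<le> (36 / r) * (\<omega> * r)"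
        unfolding abs_mult using \<kappa>(8)[of x e] FL[OF d] r e by (intro mult_mono) auto
      moreover have "(36 / r) * (\<omega> * r) = 36 * \<omega>" using r by simp
      ultimately show ?thesis by (simp add: \<Phi>'_def ee \<omega>_def abs_le_iff)
    qed
    show "\<Phi> x = M * ((x - x0) \<bullet> e)" if "dist x x0 \<ge> r" using \<kappa>(6)[OF that] by (simp add: \<Phi>_def L_def)
    show "\<Phi> x = F x" if "dist x x0 < r / 4" using \<kappa>(5)[OF that] by (simp add: \<Phi>_def)
  qed (use e M r in auto)
qed

lemma frontier_superlevel_set_zero:
  fixes F :: "'a::topological_space \<Rightarrow> real"
  assumes "continuous_on UNIV F" "x \<in> frontier {x. F x > 0}"
  shows "F x = 0"
proof -
  have "closed {x. F x \<ge> 0}" "open {x. F x > 0}"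
    using assms(1) by (auto intro!: closed_Collect_le open_Collect_less)
  then have "closure {x. F x > 0} \<subseteq> {x. F x \<ge> 0}"
    by (intro closure_minimal) auto
  moreover have "interior {x. F x > 0} = {x. F x > 0}"
    using \<open>open {x. F x > 0}\<close> by (rule interior_open)
  ultimately show ?thesis using assms(2) by (fastforce simp: frontier_def)
qed

lemma regular_superlevel_set_smooth_domain:
  fixes F :: "'a::euclidean_space \<Rightarrow> real"
  assumes \<alpha>: "0 < \<alpha>" "\<alpha> < 1" and C2: "loc_C2_Holder \<alpha> F"
    and der: "\<And>x. (F has_derivative F' x) (at x)"
    and regular: "\<And>x. x \<in> frontier {x. F x > 0} \<Longrightarrow> F' x \<noteq> (\<lambda>v. 0)"
  shows "C2_Holder_smooth_domain \<alpha> {x. F x > 0}"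
  unfolding C2_Holder_smooth_domain_def
proof
  fix x0 assume x0: "x0 \<in> frontier {x. F x > 0}"
  have "continuous_on UNIV F"
    using der has_derivative_continuous by (metis continuous_at_imp_continuous_on)
  then have F0: "F x0 = 0" using x0 by (rule frontier_superlevel_set_zero)
  obtain \<Phi> e M r \<Phi>' where \<Phi>: "loc_C2_Holder \<alpha> \<Phi>" "norm e = 1" "M > 0" "r > 0"
    "\<And>x. (\<Phi> has_derivative \<Phi>' x) (at x)" "\<And>x. \<Phi>' x e \<ge> M / 2"
    "\<And>x. dist x x0 \<ge> r \<Longrightarrow> \<Phi> x = M * ((x - x0) \<bullet> e)"
    "\<And>x. dist x x0 < r / 4 \<Longrightarrow> \<Phi> x = F x"
    by (rule straighten_at_regular_point[OF \<alpha> C2 der F0 regular[OF x0]]) (rule that)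
  have M2: "M / 2 > 0" using \<Phi>(3) by simp
  obtain f where f: "C2_Holder \<alpha> f" "\<And>x s. f (x + s *\<^sub>R e) = f x" "\<And>x. \<Phi> x > 0 \<longleftrightarrow> f x < x \<bullet> e"
    by (rule zero_set_is_graph[OF \<alpha> \<Phi>(1,2) M2 \<Phi>(5,6)], erule \<Phi>(7)) (rule that)
  have "x \<in> {x. 0 < F x} \<longleftrightarrow> f x < x \<bullet> e" if "x \<in> ball x0 (r / 4)" for x
    using f(3)[of x] \<Phi>(8)[of x] that by (simp add: dist_commute)
  then show "\<exists>r>0. \<exists>e f. norm e = 1 \<and> C2_Holder \<alpha> f \<and> (\<forall>x s. f (x + s *\<^sub>R e) = f x) \<and>
      (\<forall>x\<in>ball x0 r. (x \<in> {x. 0 < F x}) = (f x < x \<bullet> e))"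
    using \<Phi>(2,4) f(1,2) by (intro exI[of _ "r / 4"] conjI exI[of _ e] exI[of _ f]) auto
qed


section \<open>Cutting down a smooth domain\<close>

definition bump :: "'a::euclidean_space \<Rightarrow> real \<Rightarrow> 'a \<Rightarrow> real" where
  "bump p r x = max 0 (r\<^sup>2 - (dist x p)\<^sup>2) ^ 3"

lemma bump_nonneg: "0 \<le> bump p r x"
  by (simp add: bump_def)

lemma bump_pos_iff:
  assumes "r > 0"
  shows "0 < bump p r x \<longleftrightarrow> x \<in> ball p r"
proof -
  have "0 < bump p r x \<longleftrightarrow> (dist x p)\<^sup>2 < r\<^sup>2" by (auto simp: bump_def max_def)
  also have "\<dots> \<longleftrightarrow> x \<in> ball p r"
    using assms by (auto simp: dist_commute intro: power_strict_mono dest: power2_less_imp_less)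
  finally show ?thesis .
qed

lemma bump_zero_iff: "r > 0 \<Longrightarrow> bump p r x = 0 \<longleftrightarrow> x \<notin> ball p r"
  using bump_pos_iff[of r p x] bump_nonneg[of p r x] by linarith

lemma loc_C2_Holder_bump:
  assumes \<alpha>: "0 < \<alpha>" "\<alpha> < 1"
  shows "loc_C2_Holder \<alpha> (bump p r)"
  unfolding bump_def[abs_def]
  by (intro loc_C2_Holder_pos_part_cube[OF \<alpha>] loc_C2_Holder_diff[OF \<alpha>] loc_C2_Holder_const[OF \<alpha>]
      loc_C2_Holder_dist2[OF \<alpha>])

lemma loc_C2_Holder_continuous:
  assumes \<alpha>: "0 < \<alpha>" "\<alpha> < 1" and "loc_C2_Holder \<alpha> f"
  shows "continuous_on UNIV f"
  by (intro loc_Holder_continuous[OF \<alpha>] loc_C1_Holder_imp_loc_Holder[OF \<alpha>]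
      loc_C2_Holder_imp_loc_C1_Holder[OF \<alpha>] assms(3))

lemma compact_ball_cover:
  fixes A :: "'a::euclidean_space set"
  assumes "compact A" "\<And>x. x \<in> A \<Longrightarrow> r x > 0"
  obtains I where "finite I" "I \<subseteq> A" "\<And>x. x \<in> A \<Longrightarrow> \<exists>i\<in>I. x \<in> ball i (r i)"
proof -
  have cover: "A \<subseteq> (\<Union>x\<in>A. ball x (r x))"
  proof
    fix x assume "x \<in> A"
    then show "x \<in> (\<Union>x\<in>A. ball x (r x))" using assms(2)[of x] by (intro UN_I[of x]) simp_all
  qed
  obtain I where I: "I \<subseteq> A" "finite I" "A \<subseteq> (\<Union>x\<in>I. ball x (r x))"
    by (rule compactE_image[OF assms(1) open_ball cover]) (rule that)
  have "\<exists>i\<in>I. x \<in> ball i (r i)" if "x \<in> A" for x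
    using subsetD[OF I(3) that] by (simp only: UN_iff)
  with I(1,2) show thesis by (intro that)
qed

text \<open>
  Sums of bump functions over a finite cover of \<open>A\<close> by balls disjoint from \<open>K\<close>.
\<close>

lemma smooth_separation:
  fixes A K :: "'a::euclidean_space set"
  assumes \<alpha>: "0 < \<alpha>" "\<alpha> < 1" and A: "compact A" and K: "closed K" and disj: "A \<inter> K = {}"
  obtains \<mu> R where "loc_C2_Holder \<alpha> \<mu>" "\<And>x. \<mu> x \<ge> 0" "\<And>x. x \<in> K \<Longrightarrow> \<mu> x = 0"
    "\<And>x. x \<in> A \<Longrightarrow> \<mu> x \<ge> 1" "\<And>x. norm x > R \<Longrightarrow> \<mu> x = 0"
proof (cases "A = {}")
  case True
  show thesis by (rule that[of "\<lambda>x. 0" 0]) (use True loc_C2_Holder_const[OF \<alpha>] in auto)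
next
  case False
  have "\<exists>r>0. r \<le> 1 \<and> ball x r \<inter> K = {}" if "x \<in> A" for x
  proof -
    have "open (- K)" "x \<in> - K" using K disj that by auto
    then obtain r where "r > 0" "ball x r \<subseteq> - K" using open_contains_ball by blast
    then show ?thesis by (intro exI[of _ "min r 1"]) auto
  qed
  then obtain r where r: "\<And>x. x \<in> A \<Longrightarrow> r x > 0" "\<And>x. x \<in> A \<Longrightarrow> r x \<le> 1"
    "\<And>x. x \<in> A \<Longrightarrow> ball x (r x) \<inter> K = {}" by metis
  obtain I where I: "finite I" "I \<subseteq> A" "\<And>x. x \<in> A \<Longrightarrow> \<exists>i\<in>I. x \<in> ball i (r i)"
    by (rule compact_ball_cover[OF A, of r], erule r(1)) (rule that)
  define \<mu>0 where "\<mu>0 x = (\<Sum>i\<in>I. bump i (r i) x)" for x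
  have C2: "loc_C2_Holder \<alpha> \<mu>0" unfolding \<mu>0_def[abs_def]
    by (intro loc_C2_Holder_sum[OF \<alpha>] loc_C2_Holder_bump[OF \<alpha>])
  have nn: "\<mu>0 x \<ge> 0" for x unfolding \<mu>0_def by (intro sum_nonneg bump_nonneg)
  have pos: "\<mu>0 x > 0" if x: "x \<in> A" for x
  proof -
    obtain i where i: "i \<in> I" "x \<in> ball i (r i)" using I(3)[OF x] by blast
    then have "0 < bump i (r i) x" using bump_pos_iff[of "r i" i x] r(1)[of i] I(2) by auto
    then show ?thesis unfolding \<mu>0_def by (intro sum_pos2[OF I(1) i(1)]) (auto simp: bump_nonneg)
  qed
  have "continuous_on A \<mu>0"
    by (rule continuous_on_subset[OF loc_C2_Holder_continuous[OF \<alpha> C2]]) simp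
  then obtain x1 where x1: "x1 \<in> A" "\<And>x. x \<in> A \<Longrightarrow> \<mu>0 x1 \<le> \<mu>0 x"
    using continuous_attains_inf[OF A False] by blast
  obtain R0 where R0: "\<And>x. x \<in> A \<Longrightarrow> norm x \<le> R0"
    using compact_imp_bounded[OF A] unfolding bounded_iff by blast
  show thesis
  proof (rule that[of "\<lambda>x. (1 / \<mu>0 x1) * \<mu>0 x" "R0 + 1"])
    show "loc_C2_Holder \<alpha> (\<lambda>x. (1 / \<mu>0 x1) * \<mu>0 x)"
      by (intro loc_C2_Holder_mult[OF \<alpha>] loc_C2_Holder_const[OF \<alpha>] C2)
    fix x
    show "(1 / \<mu>0 x1) * \<mu>0 x \<ge> 0" using nn by simp
    show "(1 / \<mu>0 x1) * \<mu>0 x \<ge> 1" if "x \<in> A" using x1(2)[OF that] pos[OF x1(1)] by simp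
    show "(1 / \<mu>0 x1) * \<mu>0 x = 0" if "x \<in> K"
    proof -
      have "bump i (r i) x = 0" if "i \<in> I" for i
      proof -
        have i: "i \<in> A" using that I(2) by auto
        then have "x \<notin> ball i (r i)" using r(3)[OF i] \<open>x \<in> K\<close> by auto
        then show ?thesis using bump_zero_iff[OF r(1)[OF i], of i x] by simp
      qed
      then show ?thesis by (simp add: \<mu>0_def)
    qed
    show "(1 / \<mu>0 x1) * \<mu>0 x = 0" if x: "norm x > R0 + 1"
    proof -
      have "bump i (r i) x = 0" if "i \<in> I" for i
      proof -
        have i: "i \<in> A" using that I(2) by auto
        have "dist i x \<ge> 1"
          using x R0[OF i] norm_triangle_ineq2[of x i] by (simp add: dist_norm norm_minus_commute)
        then show ?thesis using bump_zero_iff[OF r(1)[OF i], of i x] r(2)[OF i] by simp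
      qed
      then show ?thesis by (simp add: \<mu>0_def)
    qed
  qed
qed

text \<open>
  Patch the local defining functions \<open>x \<bullet> e - f x\<close> together with nonnegative bump functions.  On its
  ball each of them is positive exactly in \<open>U\<close>, so no cancellation can occur: entering \<open>U\<close> from a
  frontier point along the axis of one patch, the sum grows at least as fast as the contribution of
  this patch.
\<close>

lemma smooth_domain_defining_function:
  fixes U :: "'a::euclidean_space set"
  assumes \<alpha>: "0 < \<alpha>" "\<alpha> < 1" and U: "bounded U" "open U" "C2_Holder_smooth_domain \<alpha> U"
  obtains \<rho> where "loc_C2_Holder \<alpha> \<rho>" "\<And>x. \<rho> x > 0 \<longleftrightarrow> x \<in> U"
    "\<And>x. x \<in> frontier U \<Longrightarrow> \<not> (\<rho> has_derivative (\<lambda>v. 0)) (at x)"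
proof -
  \<comment> \<open>Interior points get the constant \<open>1\<close>; then the clause on the axis \<open>e\<close> is void.\<close>
  define chart where "chart x r \<psi> e \<longleftrightarrow> r > 0 \<and> loc_C2_Holder \<alpha> \<psi> \<and>
      (\<forall>y\<in>ball x r. y \<in> U \<longleftrightarrow> \<psi> y > 0) \<and>
      (\<forall>y\<in>ball x r - U. \<forall>s. \<psi> (y + s *\<^sub>R e) = \<psi> y + s)" for x r \<psi> e
  have "\<exists>r \<psi> e. chart x r \<psi> e" if x: "x \<in> closure U" for x
  proof (cases "x \<in> U")
    case True
    then obtain r where "r > 0" "ball x r \<subseteq> U" using U(2) open_contains_ball by blast
    then have "chart x r (\<lambda>x. 1) 0" using loc_C2_Holder_const[OF \<alpha>, of 1] by (auto simp: chart_def)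
    then show ?thesis by blast
  next
    case False
    then have "x \<in> frontier U" using x U(2) by (simp add: frontier_def interior_open)
    then obtain r e f where f: "r > 0" "norm e = 1" "C2_Holder \<alpha> f" "\<And>x s. f (x + s *\<^sub>R e) = f x"
      "\<And>y. y \<in> ball x r \<Longrightarrow> y \<in> U \<longleftrightarrow> f y < y \<bullet> e"
      using U(3) unfolding C2_Holder_smooth_domain_def by metis
    have "loc_C2_Holder \<alpha> (\<lambda>y. e \<bullet> y - f y)"
      by (intro loc_C2_Holder_diff[OF \<alpha>] loc_C2_Holder_inner[OF \<alpha>] C2_Holder_imp_loc_C2_Holder f(3))
    moreover have "e \<bullet> (y + s *\<^sub>R e) - f (y + s *\<^sub>R e) = e \<bullet> y - f y + s" for y s
      using f(2,4) by (simp add: inner_add_right dot_square_norm)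
    ultimately have "chart x r (\<lambda>y. e \<bullet> y - f y) e"
      using f(1,5) by (auto simp: chart_def inner_commute)
    then show ?thesis by blast
  qed
  then obtain r \<psi> e where chart: "\<And>x. x \<in> closure U \<Longrightarrow> chart x (r x) (\<psi> x) (e x)" by metis
  then have
    r: "\<And>x. x \<in> closure U \<Longrightarrow> r x > 0" and
    \<psi>: "\<And>x. x \<in> closure U \<Longrightarrow> loc_C2_Holder \<alpha> (\<psi> x)"
      "\<And>x y. x \<in> closure U \<Longrightarrow> y \<in> ball x (r x) \<Longrightarrow> y \<in> U \<longleftrightarrow> \<psi> x y > 0"
      "\<And>x y s. x \<in> closure U \<Longrightarrow> y \<in> ball x (r x) - U \<Longrightarrow> \<psi> x (y + s *\<^sub>R e x) = \<psi> x y + s"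
    unfolding chart_def by blast+
  have cU: "compact (closure U)" using U(1) by (simp add: compact_closure)
  obtain I where I: "finite I" "I \<subseteq> closure U" "\<And>x. x \<in> closure U \<Longrightarrow> \<exists>i\<in>I. x \<in> ball i (r i)"
    by (rule compact_ball_cover[OF cU, of r], erule r) (rule that)
  define \<rho> where "\<rho> x = (\<Sum>i\<in>I. bump i (r i) x * \<psi> i x)" for x
  have C2: "loc_C2_Holder \<alpha> \<rho>" unfolding \<rho>_def[abs_def]
    by (intro loc_C2_Holder_sum[OF \<alpha>] loc_C2_Holder_mult[OF \<alpha>] loc_C2_Holder_bump[OF \<alpha>])
       (use I \<psi> in auto)
  have term_nonneg: "0 \<le> bump i (r i) x * \<psi> i x" if "i \<in> I" "x \<in> U" for i x
  proof (cases "x \<in> ball i (r i)")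
    case True
    then have "0 < \<psi> i x" using \<psi>(2)[of i x] I(2) that by blast
    then show ?thesis by (intro mult_nonneg_nonneg bump_nonneg) simp
  next
    case False
    then show ?thesis using bump_zero_iff[of "r i" i x] r[of i] I(2) that by auto
  qed
  have term_le: "bump i (r i) x * \<psi> i x \<le> \<rho> x" if "i \<in> I" "x \<in> U" for i x
    unfolding \<rho>_def using I(1) that term_nonneg by (intro member_le_sum) auto
  have pos: "\<rho> x > 0" if x: "x \<in> U" for x
  proof -
    obtain i where i: "i \<in> I" "x \<in> ball i (r i)" using I(3)[of x] x closure_subset by blast
    have "bump i (r i) x * \<psi> i x > 0"
      using i \<psi>(2)[of i x] x I(2) bump_pos_iff[of "r i" i x] r[of i] by auto
    then show ?thesis using term_le[OF i(1) x] by linarith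
  qed
  have nonpos: "\<rho> x \<le> 0" if x: "x \<notin> U" for x
    unfolding \<rho>_def
  proof (rule sum_nonpos)
    fix i assume i: "i \<in> I"
    show "bump i (r i) x * \<psi> i x \<le> 0"
    proof (cases "x \<in> ball i (r i)")
      case True
      then have "\<not> 0 < \<psi> i x" using \<psi>(2)[of i x] I(2) i x by blast
      then show ?thesis by (intro mult_nonneg_nonpos bump_nonneg) simp
    next
      case False
      then show ?thesis using bump_zero_iff[of "r i" i x] r[of i] I(2) i by auto
    qed
  qed
  have "\<not> (\<rho> has_derivative (\<lambda>v. 0)) (at y)" if y: "y \<in> frontier U" for y
  proof
    assume der: "(\<rho> has_derivative (\<lambda>v. 0)) (at y)"
    have yU: "y \<in> closure U" "y \<notin> U" using y U(2) by (auto simp: frontier_def interior_open)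
    obtain i where i: "i \<in> I" "y \<in> ball i (r i)" using I(3)[OF yU(1)] by blast
    have iU: "i \<in> closure U" using i I by auto
    have "\<psi> i y = 0"
    proof (rule ccontr)
      assume "\<psi> i y \<noteq> 0"
      then have "\<psi> i y < 0" using \<psi>(2)[OF iU i(2)] yU by auto
      moreover have "open {z. \<psi> i z < 0}"
        using loc_C2_Holder_continuous[OF \<alpha> \<psi>(1)[OF iU]] by (intro open_Collect_less) auto
      ultimately have "open (ball i (r i) \<inter> {z. \<psi> i z < 0})" "y \<in> ball i (r i) \<inter> {z. \<psi> i z < 0}"
        using i by auto
      then obtain z where "z \<in> U" "z \<in> ball i (r i)" "\<psi> i z < 0"
        using yU(1) unfolding closure_iff_nhds_not_empty by blast
      then show False using \<psi>(2)[OF iU, of z] by auto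
    qed
    define c where "c = bump i (r i) y"
    have c: "c > 0" using bump_pos_iff[of "r i" i y] r[OF iU] i by (simp add: c_def)
    have "open {z. bump i (r i) z > c / 2}"
      using loc_C2_Holder_continuous[OF \<alpha> loc_C2_Holder_bump[OF \<alpha>]] by (intro open_Collect_less) auto
    then have "open (ball i (r i) \<inter> {z. bump i (r i) z > c / 2})"
      "y \<in> ball i (r i) \<inter> {z. bump i (r i) z > c / 2}"
      using i c by (auto simp: c_def)
    then obtain d where d: "d > 0" "ball y d \<subseteq> ball i (r i) \<inter> {z. bump i (r i) z > c / 2}"
      using open_contains_ball by blast
    \<comment> \<open>Moving from \<open>y\<close> into \<open>U\<close> in the direction \<open>e i\<close>, the \<open>i\<close>-th summand grows at least linearly.\<close>
    define w where "w = norm (e i) + 1"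
    have w: "w > 0" "norm (e i) \<le> w" by (auto simp: w_def intro: add_nonneg_pos)
    have growth: "\<rho> (y + s *\<^sub>R e i) - \<rho> y \<ge> (c / 2) * s" if s: "0 < s" "s * w < d" for s
    proof -
      have "s * norm (e i) < d" using mult_left_mono[OF w(2), of s] s by linarith
      then have "y + s *\<^sub>R e i \<in> ball y d" using s by (simp add: dist_norm)
      then have z: "y + s *\<^sub>R e i \<in> ball i (r i)" "bump i (r i) (y + s *\<^sub>R e i) > c / 2" using d(2) by auto
      have \<psi>z: "\<psi> i (y + s *\<^sub>R e i) = s" using \<psi>(3)[OF iU, of y s] i yU \<open>\<psi> i y = 0\<close> by simp
      then have "y + s *\<^sub>R e i \<in> U" using \<psi>(2)[OF iU z(1)] s by simp
      then have "bump i (r i) (y + s *\<^sub>R e i) * s \<le> \<rho> (y + s *\<^sub>R e i)"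
        using term_le[OF i(1)] \<psi>z by metis
      moreover have "(c / 2) * s \<le> bump i (r i) (y + s *\<^sub>R e i) * s" using z s by (intro mult_right_mono) auto
      ultimately show ?thesis using nonpos[OF yU(2)] by linarith
    qed
    have "c / (4 * w) > 0" using c w(1) by simp
    then obtain \<delta> where \<delta>: "\<delta> > 0"
      "\<And>z. norm (z - y) < \<delta> \<Longrightarrow> norm (\<rho> z - \<rho> y - 0) \<le> c / (4 * w) * norm (z - y)"
      using der unfolding has_derivative_at_alt by metis
    define s where "s = min d \<delta> / (2 * w)"
    have "s * w = min d \<delta> / 2" using w(1) by (simp add: s_def)
    then have s: "s > 0" "s * w < d" "s * w < \<delta>" using d(1) \<delta>(1) w(1) by (auto simp: s_def)
    have sn: "norm ((y + s *\<^sub>R e i) - y) \<le> s * w" using mult_left_mono[OF w(2), of s] s by simp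
    have "(c / 2) * s \<le> norm (\<rho> (y + s *\<^sub>R e i) - \<rho> y - 0)" using growth[OF s(1,2)] unfolding real_norm_def by linarith
    also have "\<dots> \<le> c / (4 * w) * norm ((y + s *\<^sub>R e i) - y)" using sn s(3) by (intro \<delta>(2)) linarith
    also have "\<dots> \<le> c / (4 * w) * (s * w)" using sn c w by (intro mult_left_mono) auto
    also have "\<dots> = (c / 4) * s" using w by (simp add: field_simps)
    finally show False using c s by simp
  qed
  moreover have "\<rho> x > 0 \<longleftrightarrow> x \<in> U" for x using pos nonpos by (metis not_le)
  ultimately show thesis using C2 that by blast
qed

text \<open>
  If \<open>\<rho> - \<mu> (a \<bullet> x + c)\<close> and its derivative vanish at \<open>x\<close> and \<open>\<mu> x \<noteq> 0\<close>, then
  \<open>a\<close> is the gradient \<open>g x\<close> of \<open>\<rho> / \<mu>\<close> at \<open>x\<close> and \<open>c\<close> is determined as well.  So the bad parameters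
  \<open>(a, c)\<close> lie in the image of \<open>x \<mapsto> (g x, \<rho> x / \<mu> x - g x \<bullet> x)\<close>, a differentiable map into a space of
  one more dimension, which is a null set.
\<close>

lemma generic_affine_perturbation:
  fixes \<rho> \<mu> :: "'a::euclidean_space \<Rightarrow> real"
  assumes \<alpha>: "0 < \<alpha>" "\<alpha> < 1" and C2: "loc_C2_Holder \<alpha> \<rho>" "loc_C2_Holder \<alpha> \<mu>"
    and \<rho>': "\<And>x. (\<rho> has_derivative \<rho>' x) (at x)" and \<mu>': "\<And>x. (\<mu> has_derivative \<mu>' x) (at x)"
    and "\<epsilon> > 0"
  obtains a c where "norm a < \<epsilon>" "\<bar>c - 1\<bar> < \<epsilon>"
    "\<And>x. \<mu> x \<noteq> 0 \<Longrightarrow> \<rho> x = \<mu> x * (a \<bullet> x + c) \<Longrightarrow>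
      \<exists>v. \<rho>' x v \<noteq> \<mu>' x v * (a \<bullet> x + c) + \<mu> x * (a \<bullet> v)"
proof -
  define gr where "gr f x = (\<Sum>b\<in>Basis. f x b *\<^sub>R b)" for f :: "'a \<Rightarrow> 'a \<Rightarrow> real" and x
  define g where "g x = (1 / \<mu> x) *\<^sub>R (gr \<rho>' x - (\<rho> x / \<mu> x) *\<^sub>R gr \<mu>' x)" for x
  define \<Psi> where "\<Psi> x = (g x, \<rho> x / \<mu> x - g x \<bullet> x)" for x
  have "(\<lambda>x. f' x b) differentiable (at x)"
    if f: "loc_C2_Holder \<alpha> f" "\<And>x. (f has_derivative f' x) (at x)" for f :: "'a \<Rightarrow> real" and f' b x
  proof -
    obtain D where "\<And>x. ((\<lambda>x. f' x b) has_derivative D x) (at x)"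
      using loc_C2_Holder_derivative[OF f, of b] unfolding loc_C1_Holder_def by blast
    then show ?thesis by (rule differentiableI)
  qed
  then have gr_diff: "gr f' differentiable (at x)"
    if "loc_C2_Holder \<alpha> f" "\<And>x. (f has_derivative f' x) (at x)" for f :: "'a \<Rightarrow> real" and f' x
    unfolding gr_def[abs_def] using that by (intro differentiable_sum differentiable_scaleR ballI) auto
  have "\<Psi> differentiable (at x)" if "\<mu> x \<noteq> 0" for x
  proof -
    have d: "\<rho> differentiable (at x)" "\<mu> differentiable (at x)"
      using \<rho>' \<mu>' differentiableI by blast+
    then have q: "(\<lambda>x. \<rho> x / \<mu> x) differentiable (at x)" "(\<lambda>x. 1 / \<mu> x) differentiable (at x)"
      using that by (auto intro!: differentiable_divide)
    have "g differentiable (at x)" unfolding g_def[abs_def]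
      by (intro differentiable_scaleR differentiable_diff q gr_diff[OF C2(1) \<rho>'] gr_diff[OF C2(2) \<mu>'])
    then show ?thesis unfolding \<Psi>_def[abs_def]
      by (intro differentiable_Pair differentiable_diff q differentiable_inner) auto
  qed
  then have "\<Psi> differentiable_on {x. \<mu> x \<noteq> 0}"
    by (auto simp: differentiable_on_def intro: differentiable_at_withinI)
  then have "negligible (\<Psi> ` {x. \<mu> x \<noteq> 0})"
    by (rule negligible_differentiable_image_lowdim[rotated]) simp
  moreover have "\<not> negligible (ball (0::'a, 1::real) \<epsilon>)"
    using \<open>\<epsilon> > 0\<close> by (intro open_not_negligible) auto
  ultimately obtain p where p: "p \<in> ball (0::'a, 1::real) \<epsilon>" "p \<notin> \<Psi> ` {x. \<mu> x \<noteq> 0}"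
    using negligible_subset by blast
  obtain a c where ac: "p = (a, c)" by force
  show thesis
  proof (rule that[of a c])
    show "norm a < \<epsilon>" using p(1) dist_fst_le[of "(0, 1)" p] by (simp add: ac)
    show "\<bar>c - 1\<bar> < \<epsilon>" using p(1) dist_snd_le[of "(0, 1)" p] by (simp add: ac dist_real_def)
    fix x assume nz: "\<mu> x \<noteq> 0" and eq: "\<rho> x = \<mu> x * (a \<bullet> x + c)"
    show "\<exists>v. \<rho>' x v \<noteq> \<mu>' x v * (a \<bullet> x + c) + \<mu> x * (a \<bullet> v)"
    proof (rule ccontr)
      assume "\<not> ?thesis"
      then have *: "\<rho>' x v = \<mu>' x v * (a \<bullet> x + c) + \<mu> x * (a \<bullet> v)" for v by blast
      have "gr \<rho>' x = (a \<bullet> x + c) *\<^sub>R gr \<mu>' x + \<mu> x *\<^sub>R (\<Sum>b\<in>Basis. (a \<bullet> b) *\<^sub>R b)"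
        unfolding gr_def *
        by (simp add: scaleR_add_left sum.distrib scaleR_sum_right mult.commute)
      then have "gr \<rho>' x = (a \<bullet> x + c) *\<^sub>R gr \<mu>' x + \<mu> x *\<^sub>R a" by (simp add: euclidean_representation)
      then have "g x = a" using nz eq by (simp add: g_def)
      then have "\<Psi> x = p" using nz eq by (simp add: \<Psi>_def ac)
      then show False using p(2) nz by blast
    qed
  qed
qed

text \<open>
  The essential point is that \<open>V\<close> agrees with \<open>U\<close> on \<open>K\<close>, although \<open>K\<close> may reach
  the frontier of \<open>U\<close>.  The perturbation \<open>\<mu> (a \<bullet> x + c)\<close> of the defining function vanishes on \<open>K\<close>
  together with its derivative, so the frontier of \<open>V\<close> leaves that of \<open>U\<close> tangentially and no corners
  arise.
\<close>

lemma smooth_subdomain: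
  fixes U K Q :: "'a::euclidean_space set"
  assumes \<alpha>: "0 < \<alpha>" "\<alpha> < 1" and U: "bounded U" "open U" "C2_Holder_smooth_domain \<alpha> U"
    and K: "closed K" and Q: "open Q" and KQ: "K \<subseteq> Q"
  obtains V where "open V" "V \<subseteq> U" "C2_Holder_smooth_domain \<alpha> V" "closure V \<subseteq> Q" "U \<inter> K \<subseteq> V"
proof -
  obtain \<rho> where \<rho>: "loc_C2_Holder \<alpha> \<rho>" "\<And>x. \<rho> x > 0 \<longleftrightarrow> x \<in> U"
    "\<And>x. x \<in> frontier U \<Longrightarrow> \<not> (\<rho> has_derivative (\<lambda>v. 0)) (at x)"
    by (rule smooth_domain_defining_function[OF \<alpha> U]) (rule that)
  define A where "A = closure U - Q"
  have A: "compact A" unfolding A_def using U(1) Q by (intro compact_diff) (auto simp: compact_closure)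
  have AK: "A \<inter> K = {}" using KQ by (auto simp: A_def)
  obtain \<mu>0 R0 where \<mu>0: "loc_C2_Holder \<alpha> \<mu>0" "\<And>x. \<mu>0 x \<ge> 0" "\<And>x. x \<in> K \<Longrightarrow> \<mu>0 x = 0"
    "\<And>x. x \<in> A \<Longrightarrow> \<mu>0 x \<ge> 1" "\<And>x. norm x > R0 \<Longrightarrow> \<mu>0 x = 0"
    by (rule smooth_separation[OF \<alpha> A K AK]) (rule that)
  have "compact (\<rho> ` closure U)"
    using U(1) by (intro compact_continuous_image continuous_on_subset[OF loc_C2_Holder_continuous[OF \<alpha> \<rho>(1)]])
       (auto simp: compact_closure)
  then have "bounded (\<rho> ` closure U)" by (rule compact_imp_bounded)
  then obtain B where B: "\<And>x. x \<in> closure U \<Longrightarrow> \<bar>\<rho> x\<bar> \<le> B"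
    unfolding bounded_iff by auto
  \<comment> \<open>Half of \<open>M\<close> still exceeds \<open>\<rho>\<close>, since the affine factor is only known to be at least \<open>1 / 2\<close>.\<close>
  define M where "M = 2 * \<bar>B\<bar> + 2"
  define \<mu> where "\<mu> x = M * \<mu>0 x" for x
  have \<mu>: "loc_C2_Holder \<alpha> \<mu>" "\<And>x. \<mu> x \<ge> 0" "\<And>x. x \<in> K \<Longrightarrow> \<mu> x = 0" "\<And>x. norm x > R0 \<Longrightarrow> \<mu> x = 0"
    unfolding \<mu>_def[abs_def]
    by (intro loc_C2_Holder_mult[OF \<alpha>] loc_C2_Holder_const[OF \<alpha>] \<mu>0) (use \<mu>0 in \<open>auto simp: M_def\<close>)
  have \<mu>_A: "\<mu> x \<ge> M" if "x \<in> A" for x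
    using mult_left_mono[OF \<mu>0(4)[OF that], of M] by (simp add: \<mu>_def M_def)
  define R where "R = \<bar>R0\<bar>"
  obtain \<rho>' where \<rho>': "\<And>x. (\<rho> has_derivative \<rho>' x) (at x)" using \<rho>(1) unfolding loc_C2_Holder_def by blast
  obtain \<mu>' where \<mu>': "\<And>x. (\<mu> has_derivative \<mu>' x) (at x)" using \<mu>(1) unfolding loc_C2_Holder_def by blast
  \<comment> \<open>Small enough for \<open>a \<bullet> x + c \<ge> 1 / 2\<close> on the support of \<open>\<mu>\<close>.\<close>
  define \<epsilon> where "\<epsilon> = 1 / (4 * (R + 1))"
  have \<epsilon>: "\<epsilon> > 0" "\<epsilon> \<le> 1 / 4" "\<epsilon> * R \<le> 1 / 4" by (auto simp: \<epsilon>_def R_def field_simps)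
  obtain a c where ac: "norm a < \<epsilon>" "\<bar>c - 1\<bar> < \<epsilon>"
    "\<And>x. \<mu> x \<noteq> 0 \<Longrightarrow> \<rho> x = \<mu> x * (a \<bullet> x + c) \<Longrightarrow>
      \<exists>v. \<rho>' x v \<noteq> \<mu>' x v * (a \<bullet> x + c) + \<mu> x * (a \<bullet> v)"
    by (rule generic_affine_perturbation[OF \<alpha> \<rho>(1) \<mu>(1) \<rho>' \<mu>' \<epsilon>(1)]) (rule that)
  have \<mu>_half: "\<mu> x * (a \<bullet> x + c) \<ge> \<mu> x * (1 / 2)" for x
  proof (cases "\<mu> x = 0")
    case False
    then have "norm x \<le> R" using \<mu>(4)[of x] by (force simp: R_def)
    then have "norm a * norm x \<le> \<epsilon> * R" using ac(1) \<epsilon>(1) by (intro mult_mono) auto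
    then have "\<bar>a \<bullet> x\<bar> \<le> 1 / 4" using Cauchy_Schwarz_ineq2[of a x] \<epsilon>(3) by linarith
    then have "a \<bullet> x + c \<ge> 1 / 2" using ac(2) \<epsilon>(2) by linarith
    then show ?thesis using \<mu>(2) by (intro mult_left_mono)
  qed simp
  define F where "F x = \<rho> x - \<mu> x * (a \<bullet> x + c)" for x
  define F' where "F' x v = \<rho>' x v - (\<mu> x * (a \<bullet> v) + \<mu>' x v * (a \<bullet> x + c))" for x v
  define V where "V = {x. F x > 0}"
  have F_C2: "loc_C2_Holder \<alpha> F" unfolding F_def[abs_def]
    by (intro loc_C2_Holder_diff[OF \<alpha>] loc_C2_Holder_mult[OF \<alpha>] loc_C2_Holder_add[OF \<alpha>]
        loc_C2_Holder_inner[OF \<alpha>] loc_C2_Holder_const[OF \<alpha>] \<rho>(1) \<mu>(1))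
  have F_cont: "continuous_on UNIV F" by (rule loc_C2_Holder_continuous[OF \<alpha> F_C2])
  have "((\<lambda>x. a \<bullet> x + c) has_derivative (\<lambda>v. a \<bullet> v)) (at x)" for x
    by (auto intro!: derivative_eq_intros)
  then have F': "(F has_derivative F' x) (at x)" for x
    unfolding F_def[abs_def] F'_def[abs_def]
    by (intro has_derivative_diff has_derivative_mult \<rho>' \<mu>')
  have VU: "V \<subseteq> U"
  proof
    fix x assume "x \<in> V"
    then have "\<rho> x > \<mu> x * (a \<bullet> x + c)" by (simp add: V_def F_def)
    then have "\<rho> x > 0" using \<mu>_half[of x] \<mu>(2)[of x] by linarith
    then show "x \<in> U" by (simp add: \<rho>(2))
  qed
  have "open V" unfolding V_def using F_cont by (intro open_Collect_less) auto
  have clV: "closure V \<subseteq> {x. F x \<ge> 0}" unfolding V_def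
    using F_cont by (intro closure_minimal closed_Collect_le) auto
  have "closure V \<subseteq> Q"
  proof
    fix x assume x: "x \<in> closure V"
    show "x \<in> Q"
    proof (rule ccontr)
      assume "x \<notin> Q"
      moreover have xU: "x \<in> closure U" using x closure_mono[OF VU] by blast
      ultimately have "x \<in> A" by (simp add: A_def)
      then have "\<mu> x * (a \<bullet> x + c) \<ge> M / 2" using \<mu>_A[of x] \<mu>_half[of x] by simp
      then have "F x < 0" using B[OF xU] by (simp add: F_def M_def)
      then show False using x clV by force
    qed
  qed
  moreover have "U \<inter> K \<subseteq> V" using \<mu>(3) \<rho>(2) by (auto simp: V_def F_def)
  moreover have "C2_Holder_smooth_domain \<alpha> V"
    unfolding V_def
  proof (rule regular_superlevel_set_smooth_domain[OF \<alpha> F_C2 F'])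
    fix x assume x: "x \<in> frontier {x. F x > 0}"
    have Fx: "F x = 0" by (rule frontier_superlevel_set_zero[OF F_cont x])
    show "F' x \<noteq> (\<lambda>v. 0)"
    proof (cases "\<mu> x = 0")
      case False
      have "\<rho> x = \<mu> x * (a \<bullet> x + c)" using Fx by (simp add: F_def)
      then obtain v where "\<rho>' x v \<noteq> \<mu>' x v * (a \<bullet> x + c) + \<mu> x * (a \<bullet> v)" using ac(3)[OF False] by blast
      then have "F' x v \<noteq> 0" by (simp add: F'_def)
      then show ?thesis by metis
    next
      case True
      \<comment> \<open>Here \<open>\<mu>\<close> attains its minimum, so only \<open>\<rho>\<close> contributes to the derivative.\<close>
      have "\<mu>' x = (\<lambda>v. 0)"
        using differential_zero_maxmin[of x UNIV \<mu> "\<mu>' x"] \<mu>' \<mu>(2) True by auto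
      then have "F' x = \<rho>' x" using True by (simp add: F'_def[abs_def])
      moreover have "x \<in> frontier U"
      proof -
        have "x \<in> closure U" using x closure_mono[OF VU] by (auto simp: frontier_def V_def)
        moreover have "x \<notin> U" using Fx True \<rho>(2)[of x] by (simp add: F_def)
        ultimately show ?thesis using U(2) by (simp add: frontier_def interior_open)
      qed
      ultimately show ?thesis using \<rho>(3)[of x] \<rho>'[of x] by auto
    qed
  qed
  ultimately show thesis using \<open>open V\<close> VU that by blast
qed


section \<open>Comparison and pasting\<close>

lemma weak_solution_subset: "weak_solution m \<Theta> u \<Longrightarrow> \<Theta>' \<subseteq> \<Theta> \<Longrightarrow> weak_solution m \<Theta>' u"
  unfolding weak_solution_def compactly_contained_def by (meson subset_trans)

lemma parabolic_subset: "parabolic m \<Theta> u \<Longrightarrow> \<Theta>' \<subseteq> \<Theta> \<Longrightarrow> parabolic m \<Theta>' u"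
  unfolding parabolic_def using weak_solution_subset continuous_on_subset by blast

lemma closure_cyl: "t1 < t2 \<Longrightarrow> closure (cyl U t1 t2) = closure U \<times> {t1..t2}"
  by (simp add: cyl_def closure_Times)

lemma superparabolicD:
  assumes "superparabolic m \<alpha> \<Theta> u" "cylinder_base U t1 t2" "C2_Holder_smooth_domain \<alpha> U"
    "compactly_contained (cyl U t1 t2) \<Theta>" "continuous_on (closure (cyl U t1 t2)) h"
    "\<And>\<xi>. \<xi> \<in> closure (cyl U t1 t2) \<Longrightarrow> 0 \<le> h \<xi>" "parabolic m (cyl U t1 t2) (\<lambda>\<xi>. ennreal (h \<xi>))"
    "\<And>\<xi>. \<xi> \<in> parabolic_boundary U t1 t2 \<Longrightarrow> ennreal (h \<xi>) \<le> u \<xi>"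
    "\<xi> \<in> cyl U t1 t2"
  shows "ennreal (h \<xi>) \<le> u \<xi>"
  using assms unfolding superparabolic_def by blast

text \<open>
  A frontier point of a smooth domain \<open>V\<close> between \<open>U \<inter> K\<close> and \<open>U \<inter> Q\<close> lies on the frontier of
  \<open>U\<close> or in \<open>U - K\<close>; this is why the hypotheses on the sides of the slab have this form.
\<close>

lemma comparison_on_slab:
  fixes \<Theta> G :: "((real ^ 'n) \<times> real) set" and h :: "(real ^ 'n) \<times> real \<Rightarrow> real"
  assumes \<alpha>: "0 < \<alpha>" "\<alpha> < 1"
    and v: "superparabolic m \<alpha> G v"
    and U: "cylinder_base U t1 t2" "C2_Holder_smooth_domain \<alpha> U"
    and h: "continuous_on (closure (cyl U t1 t2)) h" "\<And>\<xi>. \<xi> \<in> closure (cyl U t1 t2) \<Longrightarrow> 0 \<le> h \<xi>"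
      "parabolic m (cyl U t1 t2) (\<lambda>\<xi>. ennreal (h \<xi>))"
    and s: "t1 \<le> s0" "s0 < s1" "s1 < t2"
    and K: "closed K" and Q: "open Q" "K \<subseteq> Q" "Q \<times> {s0..s1} \<subseteq> G"
    and bottom: "\<And>x. x \<in> closure U \<inter> Q \<Longrightarrow> ennreal (h (x, s0)) \<le> v (x, s0)"
    and lateral: "\<And>x t. x \<in> frontier U \<inter> Q \<Longrightarrow> t \<in> {s0<..s1} \<Longrightarrow> ennreal (h (x, t)) \<le> v (x, t)"
    and off_K: "\<And>x t. x \<in> U \<inter> Q - K \<Longrightarrow> t \<in> {s0<..s1} \<Longrightarrow> ennreal (h (x, t)) \<le> v (x, t)"
    and xt: "x \<in> U \<inter> K" "t \<in> {s0<..<s1}"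
  shows "ennreal (h (x, t)) \<le> v (x, t)"
proof -
  have U': "bounded U" "open U" using U(1) by (auto simp: cylinder_base_def)
  obtain V where V: "open V" "V \<subseteq> U" "C2_Holder_smooth_domain \<alpha> V" "closure V \<subseteq> Q" "U \<inter> K \<subseteq> V"
    by (rule smooth_subdomain[OF \<alpha> U' U(2) K Q(1,2)]) (rule that)
  have clVU: "closure V \<subseteq> closure U" using V(2) by (rule closure_mono)
  have sub: "cyl V s0 s1 \<subseteq> cyl U t1 t2" using V(2) s by (auto simp: cyl_def)
  have clsub: "closure (cyl V s0 s1) \<subseteq> closure (cyl U t1 t2)" using sub by (rule closure_mono)
  have bV: "bounded V" using V(2) U'(1) bounded_subset by blast
  show ?thesis
  proof (rule superparabolicD[OF v _ V(3)])
    show "cylinder_base V s0 s1" using bV V(1) s by (simp add: cylinder_base_def)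
    show "compactly_contained (cyl V s0 s1) G"
      using V(4) Q(3) bV s
      by (auto simp: compactly_contained_def closure_cyl compact_closure intro!: compact_Times)
    show "continuous_on (closure (cyl V s0 s1)) h" using h(1) clsub by (rule continuous_on_subset)
    show "0 \<le> h \<xi>" if "\<xi> \<in> closure (cyl V s0 s1)" for \<xi> using h(2) clsub that by blast
    show "parabolic m (cyl V s0 s1) (\<lambda>\<xi>. ennreal (h \<xi>))" using h(3) sub by (rule parabolic_subset)
    show "(x, t) \<in> cyl V s0 s1" using xt V(5) by (auto simp: cyl_def)
    fix \<xi> assume \<xi>: "\<xi> \<in> parabolic_boundary V s0 s1"
    obtain y r where yr: "\<xi> = (y, r)" by force
    consider "y \<in> closure V" "r = s0" | "y \<in> frontier V" "r \<in> {s0<..s1}"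
      using \<xi> by (auto simp: yr parabolic_boundary_def)
    then show "ennreal (h \<xi>) \<le> v \<xi>"
    proof cases
      case 1
      then show ?thesis using bottom[of y] clVU V(4) yr by blast
    next
      case 2
      then have y: "y \<in> closure U" "y \<in> Q" "y \<notin> V"
        using clVU V(1,4) by (auto simp: frontier_def interior_open)
      then have "y \<in> frontier U \<or> y \<in> U - K"
        using V(5) U'(2) by (auto simp: frontier_def interior_open)
      then show ?thesis using lateral[of y r] off_K[of y r] 2 y yr by blast
    qed
  qed
qed

lemma compact_uniform_collar:
  fixes E :: "('a::euclidean_space \<times> real) set"
  assumes "compact E" "open G" "E \<subseteq> G"
  obtains \<delta> where "\<delta> > 0" "\<And>x t x' t'. (x, t) \<in> E \<Longrightarrow> dist x' x < \<delta> \<Longrightarrow> \<bar>t' - t\<bar> \<le> \<delta> \<Longrightarrow> (x', t') \<in> G"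
proof -
  have "\<exists>d>0. \<forall>x\<in>E. \<forall>y\<in>- G. d \<le> dist x y"
    using assms by (intro separate_compact_closed) auto
  then obtain d where d: "d > 0" "\<And>x y. x \<in> E \<Longrightarrow> y \<notin> G \<Longrightarrow> d \<le> dist x y" by blast
  show thesis
  proof (rule that[of "d / 3"])
    fix x x' t t' assume *: "(x, t) \<in> E" "dist x' x < d / 3" "\<bar>t' - t\<bar> \<le> d / 3"
    have "dist (x, t) (x', t') \<le> dist x x' + dist t t'"
      unfolding dist_Pair_Pair by (rule sqrt_sum_squares_le_sum) auto
    also have "\<dots> < d" using * d(1) by (simp add: dist_commute dist_real_def abs_minus_commute)
    finally show "(x', t') \<in> G" using d(2)[OF *(1)] by force
  qed (use d in simp)
qed

text \<open>
  Outside \<open>G\<close> the separation hypothesis provides a neighbourhood in which the pasted function is \<open>u\<close>.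
\<close>

lemma pasted_lower_semicontinuous:
  fixes u v :: "'a::metric_space \<Rightarrow> ennreal"
  assumes "open G" "lower_semicontinuous_on \<Theta> u" "lower_semicontinuous_on G v" "G \<subseteq> \<Theta>"
    and "closure {\<xi> \<in> G. v \<xi> < u \<xi>} \<inter> \<Theta> \<subseteq> G"
  shows "lower_semicontinuous_on \<Theta> (\<lambda>\<xi>. if \<xi> \<in> G then min (u \<xi>) (v \<xi>) else u \<xi>)"
    (is "lower_semicontinuous_on \<Theta> ?w")
  unfolding lower_semicontinuous_on_def
proof (intro ballI allI impI)
  fix \<xi> c assume \<xi>: "\<xi> \<in> \<Theta>" and c: "c < ?w \<xi>"
  have u_ev: "eventually (\<lambda>\<eta>. c < u \<eta>) (at \<xi> within \<Theta>)"
    using assms(2) \<xi> c unfolding lower_semicontinuous_on_def by (auto split: if_splits)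
  show "eventually (\<lambda>\<eta>. c < ?w \<eta>) (at \<xi> within \<Theta>)"
  proof (cases "\<xi> \<in> G")
    case True
    then have "eventually (\<lambda>\<eta>. c < v \<eta>) (at \<xi> within G)"
      using assms(3) c unfolding lower_semicontinuous_on_def by auto
    then have "eventually (\<lambda>\<eta>. c < v \<eta>) (at \<xi>)" by (simp only: at_within_open[OF True assms(1)])
    then have "eventually (\<lambda>\<eta>. c < v \<eta>) (at \<xi> within \<Theta>)"
      using filter_leD[OF at_le[of \<Theta> UNIV \<xi>]] by simp
    with u_ev show ?thesis by eventually_elim auto
  next
    case False
    let ?W = "- closure {\<xi> \<in> G. v \<xi> < u \<xi>}"
    have "open ?W" "\<xi> \<in> ?W" using False \<xi> assms(5) by auto
    then have "eventually (\<lambda>\<eta>. \<eta> \<in> ?W) (at \<xi>)" by (rule eventually_at_in_open')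
    then have "eventually (\<lambda>\<eta>. \<eta> \<in> ?W) (at \<xi> within \<Theta>)"
      using filter_leD[OF at_le[of \<Theta> UNIV \<xi>]] by simp
    with u_ev show ?thesis
    proof eventually_elim
      case (elim \<eta>)
      then have "\<eta> \<notin> {\<xi> \<in> G. v \<xi> < u \<xi>}"
        using closure_subset[of "{\<xi> \<in> G. v \<xi> < u \<xi>}"] by blast
      then have "?w \<eta> = u \<eta>" by (simp add: not_less min_absorb1)
      then show ?case using elim(1) by simp
    qed
  qed
qed

text \<open>
  The predicate \<open>ok s\<close> says that \<open>h \<le> w\<close> up to and including the time \<open>s\<close>.  A step from \<open>s0\<close>
  uses a slab reaching slightly beyond the new time \<open>s\<close>, because the comparison is only available in open
  cylinders, and ending before \<open>t2\<close>, because \<open>h \<le> u\<close> is not known at the time \<open>t2\<close>.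
\<close>

lemma pasted_comparison:
  fixes \<Theta> G :: "((real ^ 'n) \<times> real) set"
    and u v w :: "(real ^ 'n) \<times> real \<Rightarrow> ennreal" and h :: "(real ^ 'n) \<times> real \<Rightarrow> real"
  assumes \<alpha>: "0 < \<alpha>" "\<alpha> < 1"
    and G: "open G" "G \<subseteq> \<Theta>"
    and u: "superparabolic m \<alpha> \<Theta> u" and v: "superparabolic m \<alpha> G v"
    and w: "w = (\<lambda>\<xi>. if \<xi> \<in> G then min (u \<xi>) (v \<xi>) else u \<xi>)"
    and sep: "closure {\<xi> \<in> G. v \<xi> < u \<xi>} \<inter> \<Theta> \<subseteq> G"
    and U: "cylinder_base U t1 t2" "C2_Holder_smooth_domain \<alpha> U" "compactly_contained (cyl U t1 t2) \<Theta>"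
    and h: "continuous_on (closure (cyl U t1 t2)) h" "\<And>\<xi>. \<xi> \<in> closure (cyl U t1 t2) \<Longrightarrow> 0 \<le> h \<xi>"
      "parabolic m (cyl U t1 t2) (\<lambda>\<xi>. ennreal (h \<xi>))"
    and bdry: "\<And>\<xi>. \<xi> \<in> parabolic_boundary U t1 t2 \<Longrightarrow> ennreal (h \<xi>) \<le> w \<xi>"
    and "\<xi> \<in> cyl U t1 t2"
  shows "ennreal (h \<xi>) \<le> w \<xi>"
proof -
  have U': "bounded U" "open U" "t1 < t2" using U(1) by (auto simp: cylinder_base_def)
  have wu: "w \<xi> \<le> u \<xi>" for \<xi> by (simp add: w)
  have wv: "w \<xi> \<le> v \<xi>" if "\<xi> \<in> G" for \<xi> using that by (simp add: w)
  have hu: "ennreal (h \<xi>) \<le> u \<xi>" if "\<xi> \<in> cyl U t1 t2" for \<xi>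
    by (rule superparabolicD[OF u U h _ that]) (use bdry wu order_trans in blast)+
  define C where "C = closure U \<times> {t1..t2}"
  have clC: "closure (cyl U t1 t2) = C" using U'(3) by (simp add: C_def closure_cyl)
  have C: "compact C" "C \<subseteq> \<Theta>" using U(3) unfolding compactly_contained_def clC by auto
  define E where "E = closure {\<xi> \<in> G. v \<xi> < u \<xi>} \<inter> C"
  have E: "compact E" "E \<subseteq> G" unfolding E_def using C sep by auto
  have in_E: "\<xi> \<in> E" if "\<xi> \<in> G" "\<xi> \<in> C" "\<not> u \<xi> \<le> v \<xi>" for \<xi>
    unfolding E_def using that closure_subset[of "{\<xi> \<in> G. v \<xi> < u \<xi>}"] by auto
  obtain \<delta> where \<delta>: "\<delta> > 0"
    "\<And>x t x' t'. (x, t) \<in> E \<Longrightarrow> dist x' x < \<delta> \<Longrightarrow> \<bar>t' - t\<bar> \<le> \<delta> \<Longrightarrow> (x', t') \<in> G"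
    using compact_uniform_collar[OF E(1) G(1) E(2)] by blast
  define ok where "ok s \<longleftrightarrow> (\<forall>x\<in>closure U. \<forall>t\<in>{t1..s}. ennreal (h (x, t)) \<le> w (x, t))" for s
  have on_boundary: "ennreal (h (x, t)) \<le> w (x, t)" if "x \<in> frontier U" "t \<in> {t1<..t2}" for x t
    using bdry that by (simp add: parabolic_boundary_def)
  have ok_start: "ok t1"
    unfolding ok_def using bdry by (simp add: parabolic_boundary_def)
  have advance: "ok s" if s0: "ok s0" "t1 \<le> s0" and s: "s0 < s" "s < t2" "s < s0 + \<delta>" for s0 s
  proof -
    define s1 where "s1 = (s + min t2 (s0 + \<delta>)) / 2"
    have s1: "s < s1" "s1 < t2" "s1 < s0 + \<delta>" using s by (auto simp: s1_def min_def)
    define K where "K = fst ` (E \<inter> (UNIV \<times> {s0..s1}))"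
    define Q where "Q = (\<Union>x\<in>K. ball x \<delta>)"
    have "compact K" unfolding K_def
      by (intro compact_continuous_image continuous_on_fst compact_Int_closed E(1) closed_Times) auto
    then have K: "closed K" by (rule compact_imp_closed)
    have Q: "open Q" "K \<subseteq> Q" using \<delta>(1) by (auto simp: Q_def)
    have QG: "Q \<times> {s0..s1} \<subseteq> G"
    proof clarify
      fix x t assume x: "x \<in> Q" and t: "t \<in> {s0..s1}"
      then obtain y r where "(y, r) \<in> E" "r \<in> {s0..s1}" "dist x y < \<delta>"
        by (auto simp: Q_def K_def dist_commute)
      then show "(x, t) \<in> G" using \<delta>(2)[of y r x t] t s1 by auto
    qed
    have off_K: "ennreal (h (x, t)) \<le> v (x, t)" if "x \<in> U \<inter> Q - K" "t \<in> {s0<..s1}" for x t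
    proof -
      have C: "(x, t) \<in> C" using that s0 s1 closure_subset by (auto simp: C_def)
      have "(x, t) \<notin> E" using that by (force simp: K_def)
      moreover have "(x, t) \<in> G" using QG that by auto
      ultimately have "u (x, t) \<le> v (x, t)" using in_E C by blast
      moreover have "ennreal (h (x, t)) \<le> u (x, t)"
        using that s0 s1 by (intro hu) (auto simp: cyl_def)
      ultimately show ?thesis by (rule order_trans[rotated])
    qed
    have hv: "ennreal (h (x, t)) \<le> v (x, t)" if "x \<in> U \<inter> K" "t \<in> {s0<..<s1}" for x t
    proof (rule comparison_on_slab[OF \<alpha> v U(1,2) h s0(2) _ s1(2) K Q QG])
      fix x assume x: "x \<in> closure U \<inter> Q"
      then have "ennreal (h (x, s0)) \<le> w (x, s0)" using s0 by (auto simp: ok_def)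
      also have "\<dots> \<le> v (x, s0)" using x QG s s1 by (intro wv) auto
      finally show "ennreal (h (x, s0)) \<le> v (x, s0)" .
    next
      fix x t assume x: "x \<in> frontier U \<inter> Q" and t: "t \<in> {s0<..s1}"
      then have "ennreal (h (x, t)) \<le> w (x, t)" using s0 s1 by (intro on_boundary) auto
      also have "\<dots> \<le> v (x, t)" using x t QG by (intro wv) auto
      finally show "ennreal (h (x, t)) \<le> v (x, t)" .
    qed (use that off_K s s1 in auto)
    show "ok s"
      unfolding ok_def
    proof (intro ballI)
      fix x t assume x: "x \<in> closure U" and t: "t \<in> {t1..s}"
      consider "t \<le> s0" | "t > s0" "x \<in> frontier U" | "t > s0" "x \<in> U"
        using x U'(2) by (cases "t \<le> s0") (auto simp: frontier_def interior_open)
      then show "ennreal (h (x, t)) \<le> w (x, t)"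
      proof cases
        case 1
        then show ?thesis using s0 x t by (auto simp: ok_def)
      next
        case 2
        then show ?thesis using s0 s t by (intro on_boundary) auto
      next
        case 3
        have hu': "ennreal (h (x, t)) \<le> u (x, t)" using 3 s0 s t by (intro hu) (auto simp: cyl_def)
        have "ennreal (h (x, t)) \<le> v (x, t)" if "(x, t) \<in> G"
        proof (cases "u (x, t) \<le> v (x, t)")
          case True
          then show ?thesis using hu' by (rule order_trans[rotated])
        next
          case False
          have "(x, t) \<in> C" using x s t by (auto simp: C_def)
          then have "(x, t) \<in> E" using in_E that False by blast
          then have "x \<in> K" using 3 t s1 by (force simp: K_def)
          then show ?thesis using 3 t s1 by (intro hv) auto
        qed
        then show ?thesis using hu' by (simp add: w)
      qed
    qed
  qed
  have steps: "\<forall>s. t1 \<le> s \<and> s < t2 \<and> s \<le> t1 + real k * (\<delta> / 2) \<longrightarrow> ok s" for k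
  proof (induction k)
    case 0
    then show ?case using ok_start by auto
  next
    case (Suc k)
    show ?case
    proof (intro allI impI)
      fix s assume s: "t1 \<le> s \<and> s < t2 \<and> s \<le> t1 + real (Suc k) * (\<delta> / 2)"
      define s0 where "s0 = max t1 (s - \<delta> / 2)"
      have s0: "t1 \<le> s0" "s0 \<le> s" "s < s0 + \<delta>" "s0 \<le> t1 + real k * (\<delta> / 2)"
        using s \<delta>(1) by (auto simp: s0_def algebra_simps add_divide_distrib)
      then have "ok s0" using Suc.IH s by auto
      then show "ok s" using advance[of s0 s] s0 s by (cases "s = s0") auto
    qed
  qed
  obtain x t where xt: "\<xi> = (x, t)" "x \<in> U" "t1 < t" "t < t2" using assms by (auto simp: cyl_def)
  obtain k where "(t - t1) / (\<delta> / 2) < real k" using reals_Archimedean2 by blast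
  then have "t \<le> t1 + real k * (\<delta> / 2)" using \<delta>(1) by (simp add: field_simps)
  then have "ok t" using steps[of k] xt by auto
  moreover have "x \<in> closure U" using xt(2) closure_subset by blast
  ultimately show ?thesis using xt by (simp add: ok_def)
qed

theorem lemma5p5:
  fixes m \<alpha> :: real
    and \<Theta> G :: "((real ^ 'n) \<times> real) set"
    and u v w :: "(real ^ 'n) \<times> real \<Rightarrow> ennreal"
  assumes "CARD('n) \<ge> 2"
    and "m \<ge> 1"
    and "0 < \<alpha>" and "\<alpha> < 1"
    and "open \<Theta>" and "open G" and "G \<subseteq> \<Theta>"
    and "superparabolic m \<alpha> \<Theta> u"
    and "superparabolic m \<alpha> G v"
    and "w = (\<lambda>\<xi>. if \<xi> \<in> G then min (u \<xi>) (v \<xi>) else u \<xi>)"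
    and "closure {\<xi> \<in> G. v \<xi> < u \<xi>} \<inter> \<Theta> \<subseteq> G"
  shows "superparabolic m \<alpha> \<Theta> w"
proof -
  have u: "lower_semicontinuous_on \<Theta> u" "\<Theta> \<subseteq> closure {\<xi>\<in>\<Theta>. u \<xi> < \<infinity>}"
    and v: "lower_semicontinuous_on G v"
    using assms(8,9) by (simp_all add: superparabolic_def)
  have lsc: "lower_semicontinuous_on \<Theta> w"
    unfolding assms(10) by (rule pasted_lower_semicontinuous[OF assms(6) u(1) v assms(7,11)])
  have "{\<xi>\<in>\<Theta>. u \<xi> < \<infinity>} \<subseteq> {\<xi>\<in>\<Theta>. w \<xi> < \<infinity>}"
    by (auto simp: assms(10) min_less_iff_disj)
  then have dense_finite: "\<Theta> \<subseteq> closure {\<xi>\<in>\<Theta>. w \<xi> < \<infinity>}"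
    by (rule subset_trans[OF u(2) closure_mono])
  show ?thesis
    unfolding superparabolic_def
  proof (intro conjI allI impI ballI lsc dense_finite, elim conjE)
    fix U t1 t2 and h :: "(real ^ 'n) \<times> real \<Rightarrow> real" and \<xi>
    assume U: "cylinder_base U t1 t2" "C2_Holder_smooth_domain \<alpha> U"
        "compactly_contained (cyl U t1 t2) \<Theta>"
      and h: "continuous_on (closure (cyl U t1 t2)) h" "\<forall>\<xi>\<in>closure (cyl U t1 t2). 0 \<le> h \<xi>"
        "parabolic m (cyl U t1 t2) (\<lambda>\<xi>. ennreal (h \<xi>))"
      and bdry: "\<forall>\<xi>\<in>parabolic_boundary U t1 t2. ennreal (h \<xi>) \<le> w \<xi>"
      and \<xi>: "\<xi> \<in> cyl U t1 t2"
    show "ennreal (h \<xi>) \<le> w \<xi>"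
      by (rule pasted_comparison[OF assms(3,4,6-11) U h(1) _ h(3) _ \<xi>]) (use h(2) bdry in auto)
  qed
qed

end
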